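(* Let $K$ be a field and let $S=K[t_1,\ldots,t_s]$, $s\geq 2$, be a polynomial ring with the standard grading. Let $1\leq p\leq s-1$, let $1\leq c_p\leq c_{p+1}$ be integers, set $d_{p+1}=c_p+c_{p+1}$, let $d_i\geq 1$ be integers for all $i\in\{2,\ldots,s\}$, $i\neq p+1$, and let $L$ be the ideal of $S$ generated by $$t_1^{d_2},\ldots,t_{p-1}^{d_p},\ t_p^{c_p}t_{p+1}^{c_{p+1}},\ t_{p+2}^{d_{p+2}},\ldots,t_s^{d_s}.$$ (A) If $t^a=t_1^{a_1}\cdots t_s^{a_s}$ is not in $L$ and $a_i\geq 1$ for some $i$, then $\deg(S/(L,t^a))$ is equal to: (i) $d_2\cdots d_s-(c_{p+1}-a_{p+1})\prod_{i=1}^{p-1}(d_{i+1}-a_i)\prod_{i=p+2}^s(d_i-a_i)$ if $a_p\geq c_p$; (ii.1) $d_2\cdots d_s-(c_p-a_p)\prod_{i=1}^{p-1}(d_{i+1}-a_i)\prod_{i=p+2}^s(d_i-a_i)$ if $a_p<c_p$ and $a_{p+1}\geq c_{p+1}$; (ii.2) $d_2\cdots d_s-(d_{p+1}-a_p-a_{p+1})\prod_{i=1}^{p-1}(d_{i+1}-a_i)\prod_{i=p+2}^s(d_i-a_i)$ if $a_p<c_p$ and $a_{p+1}<c_{p+1}$. (B) Let $\prec$ be a graded monomial order on $S$ and let $I$ be a graded ideal of $S$ such that $L={\rm in}_\prec(I)$. If $0\leq k\leq s-2$ and $\ell$ are integers such that $d=\sum_{i=2}^{k+1}(d_i-1)+\ell$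 and $1\leq \ell\leq d_{k+2}-1$, then ${\rm fp}_I(d)\leq (d_{k+2}-\ell)\,d_{k+3}\cdots d_s$.
   Context: For a graded ideal $J$ of $S$ with $k=\dim(S/J)$ (Krull dimension) and $H_J(d)=\dim_K(S_d/J_d)$, the degree of $S/J$ is $\deg(S/J)=(k-1)!\lim_{d\to\infty}H_J(d)/d^{k-1}$ if $k\geq 1$, and $\deg(S/J)=\dim_K(S/J)$ if $k=0$. Empty products equal $1$ and empty sums equal $0$. A graded monomial order is one that compares monomials first by total degree. For a graded ideal $I$ and $d\geq 1$, $\mathcal{M}_{\prec,d}$ is the set of monomials of degree $d$ that are not in ${\rm in}_\prec(I)$ and are zero-divisors of $S/{\rm in}_\prec(I)$. The footprint function of $I$ is ${\rm fp}_I(d)=\deg(S/I)-\max\{\deg(S/({\rm in}_\prec(I),t^a))\mid t^a\in\mathcal{M}_{\prec,d}\}$ if $\mathcal{M}_{\prec,d}\neq\emptyset$, and ${\rm fp}_I(d)=\deg(S/I)$ otherwise. *)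

theory Defs
  imports
    Complex_Main
    "HOL-Library.Poly_Mapping"
    "HOL-Library.Extended_Nat"
    "HOL-Algebra.QuotRing"
    "HOL-Algebra.Embedded_Algebras"
begin

section \<open>The polynomial ring and its monomials\<close>

text \<open>
  An exponent vector \<open>a\<close> is a finitely supported function on the naturals; the variables are
  \<open>t_1, \<dots>, t_s\<close>, so that the exponent vectors of \<open>K[t_1, \<dots>, t_s]\<close> are those supported
  in \<open>{1..s}\<close>. The field \<open>K\<close> is the coefficient type.
\<close>

definition monomials :: "nat \<Rightarrow> (nat \<Rightarrow>\<^sub>0 nat) set" where
  "monomials s = {a. Poly_Mapping.keys a \<subseteq> {1..s}}"

definition mdeg :: "(nat \<Rightarrow>\<^sub>0 nat) \<Rightarrow> nat" where
  "mdeg a = (\<Sum>i\<in>Poly_Mapping.keys a. Poly_Mapping.lookup a i)"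

definition tpow :: "(nat \<Rightarrow>\<^sub>0 nat) \<Rightarrow> ((nat \<Rightarrow>\<^sub>0 nat) \<Rightarrow>\<^sub>0 'k::field)" where
  "tpow a = Poly_Mapping.single a 1"

definition poly_ring :: "nat \<Rightarrow> ((nat \<Rightarrow>\<^sub>0 nat) \<Rightarrow>\<^sub>0 'k::field) ring" where
  "poly_ring s = \<lparr>carrier = {f. Poly_Mapping.keys f \<subseteq> monomials s},
     mult = (*), one = 1, zero = 0, add = (+)\<rparr>"

lemma zero_in_monomials: "0 \<in> monomials s"
  by (simp add: monomials_def)

lemma plus_in_monomials: "a \<in> monomials s \<Longrightarrow> b \<in> monomials s \<Longrightarrow> a + b \<in> monomials s"
  using Poly_Mapping.keys_add[of a b] by (auto simp: monomials_def)

lemma cring_poly_ring: "cring (poly_ring s :: ((nat \<Rightarrow>\<^sub>0 nat) \<Rightarrow>\<^sub>0 'k::field) ring)"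
proof (rule cringI)
  let ?R = "poly_ring s :: ((nat \<Rightarrow>\<^sub>0 nat) \<Rightarrow>\<^sub>0 'k) ring"
  show "abelian_group ?R"
  proof (rule abelian_groupI)
    fix f g assume "f \<in> carrier ?R" "g \<in> carrier ?R"
    then show "f \<oplus>\<^bsub>?R\<^esub> g \<in> carrier ?R"
      using Poly_Mapping.keys_add[of f g] by (auto simp: poly_ring_def)
  next
    fix f assume "f \<in> carrier ?R"
    then show "\<exists>g\<in>carrier ?R. g \<oplus>\<^bsub>?R\<^esub> f = \<zero>\<^bsub>?R\<^esub>"
      by (intro bexI[of _ "- f"]) (auto simp: poly_ring_def)
  qed (auto simp: poly_ring_def algebra_simps)
  show "comm_monoid ?R"
  proof (rule comm_monoidI)
    fix f g assume "f \<in> carrier ?R" "g \<in> carrier ?R"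
    then show "f \<otimes>\<^bsub>?R\<^esub> g \<in> carrier ?R"
      using Poly_Mapping.keys_mult[of f g] plus_in_monomials by (fastforce simp: poly_ring_def)
  qed (auto simp: poly_ring_def algebra_simps zero_in_monomials)
qed (auto simp: poly_ring_def algebra_simps)

definition homogeneous_part :: "nat \<Rightarrow> nat \<Rightarrow> ((nat \<Rightarrow>\<^sub>0 nat) \<Rightarrow>\<^sub>0 'k::field) set" where
  "homogeneous_part s n = {f \<in> carrier (poly_ring s). \<forall>m\<in>Poly_Mapping.keys f. mdeg m = n}"

definition hom_component :: "nat \<Rightarrow> ((nat \<Rightarrow>\<^sub>0 nat) \<Rightarrow>\<^sub>0 'k::field) \<Rightarrow> ((nat \<Rightarrow>\<^sub>0 nat) \<Rightarrow>\<^sub>0 'k)" where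
  "hom_component n f =
     (\<Sum>m\<in>{m \<in> Poly_Mapping.keys f. mdeg m = n}. Poly_Mapping.single m (Poly_Mapping.lookup f m))"

definition graded_ideal :: "nat \<Rightarrow> ((nat \<Rightarrow>\<^sub>0 nat) \<Rightarrow>\<^sub>0 'k::field) set \<Rightarrow> bool" where
  "graded_ideal s J \<longleftrightarrow> ideal J (poly_ring s) \<and> (\<forall>f\<in>J. \<forall>n. hom_component n f \<in> J)"


section \<open>Krull dimension, Hilbert function and degree\<close>

text \<open>The zero ring, which has no prime ideals, receives dimension \<open>0\<close>.\<close>

definition krull_dim :: "('a, 'b) ring_scheme \<Rightarrow> enat" where
  "krull_dim R = Sup {enat n | n. \<exists>P :: nat \<Rightarrow> 'a set.
     (\<forall>i\<le>n. primeideal (P i) R) \<and> (\<forall>i<n. P i \<subset> P (Suc i))}"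

definition zero_divisor :: "('a, 'b) ring_scheme \<Rightarrow> 'a \<Rightarrow> bool" where
  "zero_divisor R x \<longleftrightarrow>
     x \<in> carrier R \<and> (\<exists>y\<in>carrier R. y \<noteq> \<zero>\<^bsub>R\<^esub> \<and> x \<otimes>\<^bsub>R\<^esub> y = \<zero>\<^bsub>R\<^esub>)"

text \<open>
  The \<open>K\<close>-dimension of the image of a subspace \<open>V\<close> of \<open>S\<close> in \<open>S/J\<close>; the scalars are the
  residue classes of the constant polynomials.
\<close>

definition quot_dim ::
    "nat \<Rightarrow> ((nat \<Rightarrow>\<^sub>0 nat) \<Rightarrow>\<^sub>0 'k::field) set \<Rightarrow> ((nat \<Rightarrow>\<^sub>0 nat) \<Rightarrow>\<^sub>0 'k) set \<Rightarrow> nat" where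
  "quot_dim s J V =
     ring.dim (poly_ring s Quot J)
       (range (\<lambda>x. J +>\<^bsub>poly_ring s\<^esub> Poly_Mapping.single 0 x))
       ((\<lambda>f. J +>\<^bsub>poly_ring s\<^esub> f) ` V)"

text \<open>The image of \<open>S_n\<close> in \<open>S/J\<close> is \<open>S_n/(S_n \<inter> J) = S_n/J_n\<close>.\<close>

definition hilbert_function :: "nat \<Rightarrow> ((nat \<Rightarrow>\<^sub>0 nat) \<Rightarrow>\<^sub>0 'k::field) set \<Rightarrow> nat \<Rightarrow> nat" where
  "hilbert_function s J n = quot_dim s J (homogeneous_part s n)"

definition quot_degree :: "nat \<Rightarrow> ((nat \<Rightarrow>\<^sub>0 nat) \<Rightarrow>\<^sub>0 'k::field) set \<Rightarrow> real" where
  "quot_degree s J =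
     (let k = the_enat (krull_dim (poly_ring s Quot J)) in
      if k \<ge> 1 then fact (k - 1) * lim (\<lambda>n. real (hilbert_function s J n) / real n ^ (k - 1))
      else real (quot_dim s J (carrier (poly_ring s))))"


section \<open>Monomial orders, initial ideals and the footprint function\<close>

text \<open>\<open>(a, b) \<in> r\<close> means that \<open>t\<^sup>a\<close> is smaller than or equal to \<open>t\<^sup>b\<close>.\<close>

definition monomial_order :: "nat \<Rightarrow> (nat \<Rightarrow>\<^sub>0 nat) rel \<Rightarrow> bool" where
  "monomial_order s r \<longleftrightarrow> well_order_on (monomials s) r \<and>
     (\<forall>a\<in>monomials s. \<forall>b\<in>monomials s. \<forall>c\<in>monomials s. (a, b) \<in> r \<longrightarrow> (a + c, b + c) \<in> r)"

definition graded_monomial_order :: "nat \<Rightarrow> (nat \<Rightarrow>\<^sub>0 nat) rel \<Rightarrow> bool" where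
  "graded_monomial_order s r \<longleftrightarrow> monomial_order s r \<and>
     (\<forall>a\<in>monomials s. \<forall>b\<in>monomials s. mdeg a < mdeg b \<longrightarrow> (a, b) \<in> r)"

definition lead_exp :: "(nat \<Rightarrow>\<^sub>0 nat) rel \<Rightarrow> ((nat \<Rightarrow>\<^sub>0 nat) \<Rightarrow>\<^sub>0 'k::field) \<Rightarrow> (nat \<Rightarrow>\<^sub>0 nat)" where
  "lead_exp r f =
     (THE m. m \<in> Poly_Mapping.keys f \<and> (\<forall>m'\<in>Poly_Mapping.keys f. (m', m) \<in> r))"

definition initial_ideal ::
    "nat \<Rightarrow> (nat \<Rightarrow>\<^sub>0 nat) rel \<Rightarrow> ((nat \<Rightarrow>\<^sub>0 nat) \<Rightarrow>\<^sub>0 'k::field) set \<Rightarrow> ((nat \<Rightarrow>\<^sub>0 nat) \<Rightarrow>\<^sub>0 'k) set" where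
  "initial_ideal s r I = Idl\<^bsub>poly_ring s\<^esub> {tpow (lead_exp r f) | f. f \<in> I \<and> f \<noteq> 0}"

definition footprint_monomials ::
    "nat \<Rightarrow> (nat \<Rightarrow>\<^sub>0 nat) rel \<Rightarrow> ((nat \<Rightarrow>\<^sub>0 nat) \<Rightarrow>\<^sub>0 'k::field) set \<Rightarrow> nat \<Rightarrow> (nat \<Rightarrow>\<^sub>0 nat) set" where
  "footprint_monomials s r I n =
     {a \<in> monomials s. mdeg a = n \<and> tpow a \<notin> initial_ideal s r I \<and>
        zero_divisor (poly_ring s Quot initial_ideal s r I)
          (initial_ideal s r I +>\<^bsub>poly_ring s\<^esub> tpow a)}"

definition fp ::
    "nat \<Rightarrow> (nat \<Rightarrow>\<^sub>0 nat) rel \<Rightarrow> ((nat \<Rightarrow>\<^sub>0 nat) \<Rightarrow>\<^sub>0 'k::field) set \<Rightarrow> nat \<Rightarrow> real" where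
  "fp s r I n =
     (if footprint_monomials s r I n \<noteq> {} then
        quot_degree s I -
          Max {quot_degree s (Idl\<^bsub>poly_ring s\<^esub> (initial_ideal s r I \<union> {tpow a})) | a.
                 a \<in> footprint_monomials s r I n}
      else quot_degree s I)"

end

theory Submission
  imports Defs "HOL-Algebra.Ring_Divisibility"
begin

text \<open>
  All degrees reduce to counting standard monomials. If a graded ideal \<open>J\<close> admits a basis of \<open>S/J\<close>
  consisting of monomials, boundedly many in each degree, and contains no power of some variable, then
  \<open>S/J\<close> has dimension \<open>1\<close>, so that its degree is the eventual number of basis monomials per degree. For a
  monomial ideal, and by Macaulay's theorem for any ideal with that initial ideal, the basis consists of
  the monomials outside the monomial ideal.

  In large degree the monomials outside \<open>L\<close> lie on thickenings of the two coordinate lines \<open>t_p\<close> and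
  \<open>t_{p+1}\<close>, and those among them that are divisible by \<open>t^a\<close> are counted by two boxes; this count is the
  amount by which passing from \<open>L\<close> to \<open>(L, t^a)\<close> lowers the degree. The bound on the footprint function
  follows by choosing \<open>a\<close> with exponents as large as possible in the first variables.
\<close>

text \<open>The degree is defined through the Krull dimension, that is, through chains of primes, so
  a count of monomials says nothing until the dimension is known to be one. For the lower bound, a
  prime avoiding all \<open>t_v^n u\<close> with \<open>u(0) \<noteq> 0\<close> lies strictly inside
  the irrelevant ideal; for the upper bound, a chain of three primes would need quadratically many
  independent classes where only linearly many monomials are available. Adding \<open>t^a\<close>
  keeps the dimension: a variable dividing \<open>t^a\<close> differs from one of
  \<open>t_p\<close>, \<open>t_{p+1}\<close>, and the line of that one survives. The three cases of
  (A) are one formula: the lines contribute the truncated differences of \<open>c p\<close> and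
  \<open>c (p + 1)\<close> with the exponents of \<open>t^a\<close>, and the case tells which of
  them is zero. For (B) one monomial suffices, since it bounds the maximum from below; it is a
  zero-divisor because every nonconstant monomial is one modulo \<open>L\<close>.\<close>

abbreviation (input) keys where "keys \<equiv> Poly_Mapping.keys"
abbreviation (input) lookup where "lookup \<equiv> Poly_Mapping.lookup"
abbreviation (input) single where "single \<equiv> Poly_Mapping.single"

type_synonym 'k mpoly = "(nat \<Rightarrow>\<^sub>0 nat) \<Rightarrow>\<^sub>0 'k"

section \<open>Ideals of the polynomial ring and their quotients\<close>

lemma poly_ring_simps [simp]:
  "f \<in> carrier (poly_ring s) \<longleftrightarrow> keys f \<subseteq> monomials s"
  "f \<otimes>\<^bsub>poly_ring s\<^esub> g = f * g"
  "f \<oplus>\<^bsub>poly_ring s\<^esub> g = f + g"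
  "\<one>\<^bsub>poly_ring s\<^esub> = 1"
  "\<zero>\<^bsub>poly_ring s\<^esub> = 0"
  by (simp_all add: poly_ring_def)

lemma poly_ring_uminus:
  fixes f :: "'k::field mpoly"
  assumes "keys f \<subseteq> monomials s"
  shows "\<ominus>\<^bsub>poly_ring s\<^esub> f = - f"
proof -
  interpret cring "poly_ring s :: 'k mpoly ring" by (rule cring_poly_ring)
  show ?thesis using assms by (intro minus_equality) auto
qed

lemma keys_tpow [simp]: "keys (tpow a :: 'k::field mpoly) = {a}"
  by (simp add: tpow_def)

lemma keys_add_subset: "keys f \<subseteq> A \<Longrightarrow> keys g \<subseteq> A \<Longrightarrow> keys (f + g) \<subseteq> A"
  using Poly_Mapping.keys_add[of f g] by blast

lemma keys_diff_subset:
  fixes f :: "'a \<Rightarrow>\<^sub>0 'b::ab_group_add"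
  shows "keys f \<subseteq> A \<Longrightarrow> keys g \<subseteq> A \<Longrightarrow> keys (f - g) \<subseteq> A"
  using Poly_Mapping.keys_diff[of f g] by blast

lemma keys_sum_subset: "(\<And>x. x \<in> X \<Longrightarrow> keys (F x) \<subseteq> A) \<Longrightarrow> keys (sum F X) \<subseteq> A"
  by (induction X rule: infinite_finite_induct) (simp_all add: keys_add_subset)

lemma keys_mult_monomials:
  "keys f \<subseteq> monomials s \<Longrightarrow> keys g \<subseteq> monomials s \<Longrightarrow> keys (f * g) \<subseteq> monomials s"
  using keys_mult[of f g] plus_in_monomials by fastforce

lemma keys_power_monomials:
  fixes f :: "'k::field mpoly"
  shows "keys f \<subseteq> monomials s \<Longrightarrow> keys (f ^ n) \<subseteq> monomials s"
  by (induction n) (simp_all add: keys_mult_monomials zero_in_monomials)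

lemma keys_const_mult_subset: "keys (single 0 c * f) \<subseteq> keys f"
  using keys_mult[of "single 0 c" f] by (auto split: if_splits)

lemma lookup_single_times [simp]: "lookup (single (0::nat \<Rightarrow>\<^sub>0 nat) c * f) m = c * lookup f m"
  by (simp flip: mult_map_scale_conv_mult add: map.rep_eq when_def)


lemma tpow_mult: "tpow a * tpow b = (tpow (a + b) :: 'k::field mpoly)"
  by (simp add: tpow_def mult_single)

lemma poly_expansion:
  fixes f :: "'k::field mpoly"
  shows "f = (\<Sum>m\<in>keys f. single 0 (lookup f m) * tpow m)"
proof (rule poly_mapping_eqI)
  fix k
  show "lookup f k = lookup (\<Sum>m\<in>keys f. single 0 (lookup f m) * tpow m) k"
    by (auto simp: lookup_sum tpow_def lookup_single when_def in_keys_iff if_distrib[of "(*) x" for x]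
        cong: if_cong)
qed

text \<open>Closure under negation comes for free: it is multiplication by the constant
  \<open>- 1\<close>.\<close>

lemma poly_idealI:
  fixes J :: "'k::field mpoly set"
  assumes sub: "\<And>f. f \<in> J \<Longrightarrow> keys f \<subseteq> monomials s"
    and zero: "0 \<in> J"
    and add: "\<And>f g. f \<in> J \<Longrightarrow> g \<in> J \<Longrightarrow> f + g \<in> J"
    and mult: "\<And>f g. f \<in> J \<Longrightarrow> keys g \<subseteq> monomials s \<Longrightarrow> g * f \<in> J"
  shows "ideal J (poly_ring s)"
proof -
  interpret R: cring "poly_ring s :: 'k mpoly ring" by (rule cring_poly_ring)
  have uminus: "- f \<in> J" if "f \<in> J" for f
  proof -
    have "keys (- 1 :: 'k mpoly) \<subseteq> monomials s" by (simp add: zero_in_monomials)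
    from mult[OF that this] show ?thesis by simp
  qed
  show ?thesis
  proof (rule idealI)
    show "subgroup J (add_monoid (poly_ring s))"
    proof (rule R.add.subgroupI)
      show "\<ominus>\<^bsub>poly_ring s\<^esub> a \<in> J" if "a \<in> J" for a
        using uminus[OF that] sub[OF that] by (simp add: poly_ring_uminus)
    qed (use sub zero add in auto)
  qed (use mult R.ring_axioms in \<open>auto simp: mult.commute\<close>)
qed

locale poly_ideal =
  fixes s :: nat and J :: "'k::field mpoly set"
  assumes is_ideal: "ideal J (poly_ring s)"
begin

sublocale R: cring "poly_ring s :: 'k mpoly ring" by (rule cring_poly_ring)
sublocale I: ideal J "poly_ring s" by (rule is_ideal)

lemma subset: "f \<in> J \<Longrightarrow> keys f \<subseteq> monomials s"
  using I.a_subset poly_ring_simps(1) by blast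

lemma zero: "0 \<in> J"
  using I.zero_closed by simp

lemma add: "f \<in> J \<Longrightarrow> g \<in> J \<Longrightarrow> f + g \<in> J"
  using I.a_closed by simp

lemma mult: "f \<in> J \<Longrightarrow> keys g \<subseteq> monomials s \<Longrightarrow> g * f \<in> J"
  using I.I_l_closed[of f g] by simp

lemma const_mult: "f \<in> J \<Longrightarrow> single 0 c * f \<in> J"
  by (rule mult) (auto simp: zero_in_monomials)

lemma uminus: "f \<in> J \<Longrightarrow> - f \<in> J"
  using const_mult[of f "- 1"] by (simp add: single_uminus)

lemma diff: "f \<in> J \<Longrightarrow> g \<in> J \<Longrightarrow> f - g \<in> J"
  using add[of f "- g"] uminus[of g] by simp

lemma sum: "(\<And>x. x \<in> X \<Longrightarrow> F x \<in> J) \<Longrightarrow> sum F X \<in> J"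
  by (induction X rule: infinite_finite_induct) (simp_all add: zero add)

lemma proper_iff: "J \<noteq> carrier (poly_ring s) \<longleftrightarrow> 1 \<notin> J"
  using I.one_imp_carrier by (auto simp: zero_in_monomials)

lemma coset_eq: "J +>\<^bsub>poly_ring s\<^esub> f = (\<lambda>j. j + f) ` J"
  by (auto simp: a_r_coset_def')

lemma coset_eq_iff: "J +>\<^bsub>poly_ring s\<^esub> f = J +>\<^bsub>poly_ring s\<^esub> g \<longleftrightarrow> f - g \<in> J"
proof
  assume "J +>\<^bsub>poly_ring s\<^esub> f = J +>\<^bsub>poly_ring s\<^esub> g"
  then have "0 + f \<in> (\<lambda>j. j + g) ` J"
    unfolding coset_eq using zero by blast
  then show "f - g \<in> J" by auto
next
  assume fg: "f - g \<in> J"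
  have "j + f \<in> (\<lambda>j. j + g) ` J" if "j \<in> J" for j
    using add[OF that fg] by (auto intro!: image_eqI[of _ _ "j + (f - g)"])
  moreover have "j + g \<in> (\<lambda>j. j + f) ` J" if "j \<in> J" for j
    using diff[OF that fg] by (auto intro!: image_eqI[of _ _ "j - (f - g)"])
  ultimately show "J +>\<^bsub>poly_ring s\<^esub> f = J +>\<^bsub>poly_ring s\<^esub> g"
    unfolding coset_eq by blast
qed

lemma coset_eq_zero_iff: "J +>\<^bsub>poly_ring s\<^esub> f = \<zero>\<^bsub>poly_ring s Quot J\<^esub> \<longleftrightarrow> f \<in> J"
proof -
  have "\<zero>\<^bsub>poly_ring s Quot J\<^esub> = J +>\<^bsub>poly_ring s\<^esub> 0"
    by (simp add: FactRing_def coset_eq)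
  then show ?thesis by (simp only: coset_eq_iff diff_zero)
qed

lemma quot_carrier: "carrier (poly_ring s Quot J) = (+>\<^bsub>poly_ring s\<^esub>) J ` carrier (poly_ring s)"
  unfolding FactRing_def A_RCOSETS_def' by auto

end


section \<open>Dimensions of graded pieces by counting monomials\<close>

text \<open>Bases of the quotient are described by representatives in S, which keeps the counting
  free of cosets until \<open>quot_dim_eq_card\<close>. Only monomials are tested;
  \<open>spans_mod_poly\<close> extends this by linearity.\<close>

definition spans_mod :: "'k::field mpoly set \<Rightarrow> (nat \<Rightarrow>\<^sub>0 nat) set \<Rightarrow> (nat \<Rightarrow>\<^sub>0 nat) set \<Rightarrow> bool" where
  "spans_mod J B X \<longleftrightarrow> (\<forall>m\<in>X. \<exists>g. keys g \<subseteq> B \<and> tpow m - g \<in> J)"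

definition indep_mod :: "'k::field mpoly set \<Rightarrow> (nat \<Rightarrow>\<^sub>0 nat) set \<Rightarrow> bool" where
  "indep_mod J B \<longleftrightarrow> (\<forall>f\<in>J. keys f \<subseteq> B \<longrightarrow> f = 0)"

lemma (in poly_ideal) spans_mod_poly:
  assumes "spans_mod J B X" and "keys f \<subseteq> X"
  shows "\<exists>g. keys g \<subseteq> B \<and> f - g \<in> J"
proof -
  obtain G where G: "\<And>m. m \<in> X \<Longrightarrow> keys (G m) \<subseteq> B \<and> tpow m - G m \<in> J"
    using assms(1) unfolding spans_mod_def by metis
  define g where "g = (\<Sum>m\<in>keys f. single 0 (lookup f m) * G m)"
  have "keys g \<subseteq> B"
    unfolding g_def using G assms(2) keys_const_mult_subset by (intro keys_sum_subset) fastforce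
  moreover have "f - g = (\<Sum>m\<in>keys f. single 0 (lookup f m) * (tpow m - G m))"
    unfolding g_def by (subst (1) poly_expansion) (simp add: sum_subtractf right_diff_distrib)
  then have "f - g \<in> J"
    using G assms(2) by (auto intro!: sum const_mult)
  ultimately show ?thesis by blast
qed

lemma subfield_constants: "subfield (range (single 0)) (poly_ring s :: 'k::field mpoly ring)"
proof -
  interpret R: cring "poly_ring s :: 'k mpoly ring" by (rule cring_poly_ring)
  let ?K = "range (single 0) :: 'k mpoly set"
  let ?U = "poly_ring s\<lparr>carrier := ?K\<rparr>"
  have carr: "?K \<subseteq> carrier (poly_ring s)"
    by (auto simp: zero_in_monomials)
  show ?thesis
  proof (rule R.subfieldI)
    show "subcring ?K (poly_ring s)"
    proof (rule R.subcringI', rule R.subringI)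
      fix h assume "h \<in> ?K"
      then obtain x where "h = single 0 x" by auto
      then show "\<ominus>\<^bsub>poly_ring s\<^esub> h \<in> ?K"
        using carr by (auto simp: poly_ring_uminus zero_in_monomials simp flip: single_uminus)
    next
      fix g h assume "g \<in> ?K" "h \<in> ?K"
      then show "g \<otimes>\<^bsub>poly_ring s\<^esub> h \<in> ?K" "g \<oplus>\<^bsub>poly_ring s\<^esub> h \<in> ?K"
        by (auto simp: mult_single simp flip: single_add)
    next
      show "\<one>\<^bsub>poly_ring s\<^esub> \<in> ?K"
        by (auto intro!: image_eqI[of _ _ 1])
    qed (rule carr)
    have "single 0 x \<in> Units ?U" if "x \<noteq> 0" for x :: 'k
      unfolding Units_def using that
      by (auto simp: poly_ring_def mult_single intro!: exI[of _ "inverse x"])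
    moreover have "0 \<notin> Units ?U"
      unfolding Units_def by (auto simp: poly_ring_def)
    moreover have "Units ?U \<subseteq> ?K"
      by (auto simp: Units_def)
    ultimately show "Units ?U = ?K - {\<zero>\<^bsub>poly_ring s\<^esub>}"
      by (auto, metis single_zero)
  qed
qed

text \<open>Dimension is generated by line extensions: allowing one more exponent \<open>b\<close>
  extends the space by the line of \<open>tpow b\<close>, since subtracting the
  \<open>b\<close>-term of \<open>f\<close> leaves support in \<open>B\<close>.\<close>

lemma dimension_keys_subset:
  assumes "finite B" and "B \<subseteq> monomials s"
  shows "ring.dimension (poly_ring s) (card B) (range (single 0)) {f :: 'k::field mpoly. keys f \<subseteq> B}"
  using assms
proof (induction B)
  case empty
  interpret R: cring "poly_ring s :: 'k mpoly ring" by (rule cring_poly_ring)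
  show ?case using R.zero_dim[of "range (single 0)"] by simp
next
  case (insert b B)
  interpret R: cring "poly_ring s :: 'k mpoly ring" by (rule cring_poly_ring)
  let ?E = "{f :: 'k mpoly. keys f \<subseteq> B}"
  have "{f :: 'k mpoly. keys f \<subseteq> insert b B} = R.line_extension (range (single 0)) (tpow b) ?E"
  proof (rule Set.set_eqI)
    fix f :: "'k mpoly"
    have "keys f \<subseteq> insert b B \<longleftrightarrow> (\<exists>c. keys (f - single 0 c * tpow b) \<subseteq> B)"
    proof
      assume f: "keys f \<subseteq> insert b B"
      have "x \<in> B" if "x \<in> keys (f - single 0 (lookup f b) * tpow b)" for x
      proof -
        have "lookup f x \<noteq> lookup f b * (1 when b = x)"
          using that by (simp add: in_keys_iff lookup_minus tpow_def lookup_single)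
        then have "x \<noteq> b" "x \<in> keys f"
          by (auto simp: in_keys_iff when_def split: if_splits)
        then show ?thesis using f by auto
      qed
      then show "\<exists>c. keys (f - single 0 c * tpow b) \<subseteq> B"
        by blast
    next
      assume "\<exists>c. keys (f - single 0 c * tpow b) \<subseteq> B"
      then obtain c where "keys (f - single 0 c * tpow b) \<subseteq> insert b B" by blast
      moreover have "keys (single 0 c * tpow b :: 'k mpoly) \<subseteq> insert b B"
        using keys_const_mult_subset[of c "tpow b"] by auto
      ultimately have "keys (f - single 0 c * tpow b + single 0 c * tpow b) \<subseteq> insert b B"
        by (rule keys_add_subset)
      then show "keys f \<subseteq> insert b B" by simp
    qed
    also have "\<dots> \<longleftrightarrow> f \<in> R.line_extension (range (single 0)) (tpow b) ?E"
    proof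
      assume "\<exists>c. keys (f - single 0 c * tpow b) \<subseteq> B"
      then obtain c where "keys (f - single 0 c * tpow b) \<subseteq> B" ..
      then show "f \<in> R.line_extension (range (single 0)) (tpow b) ?E"
        unfolding R.line_extension_mem_iff
        by (intro bexI[of _ "single 0 c"] bexI[of _ "f - single 0 c * tpow b"]) auto
    next
      assume "f \<in> R.line_extension (range (single 0)) (tpow b) ?E"
      then obtain c g where "f = single 0 c * tpow b + g" "keys g \<subseteq> B"
        by (auto simp: R.line_extension_mem_iff)
      then show "\<exists>c. keys (f - single 0 c * tpow b) \<subseteq> B"
        by (intro exI[of _ c]) simp
    qed
    finally show "f \<in> {f. keys f \<subseteq> insert b B} \<longleftrightarrow> f \<in> R.line_extension (range (single 0)) (tpow b) ?E"
      by simp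
  qed
  moreover have "R.dimension (Suc (card B)) (range (single 0)) (R.line_extension (range (single 0)) (tpow b) ?E)"
    using insert by (intro R.Suc_dim) auto
  ultimately show ?case using insert by simp
qed

text \<open>By independence the quotient map is injective on the span of \<open>B\<close>, and it
  has the same image there as on \<open>V\<close>. That 1 is outside \<open>J\<close> keeps the
  image of the constants a field.\<close>

lemma (in poly_ideal) quot_dim_eq_card:
  assumes "1 \<notin> J" and B: "finite B" "B \<subseteq> monomials s"
    and indep: "indep_mod J B"
    and V: "\<And>f. keys f \<subseteq> B \<Longrightarrow> f \<in> V" "\<And>f. f \<in> V \<Longrightarrow> \<exists>g. keys g \<subseteq> B \<and> f - g \<in> J"
  shows "quot_dim s J V = card B"
proof -
  let ?h = "(+>\<^bsub>poly_ring s\<^esub>) J" and ?K = "range (single 0) :: 'k mpoly set"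
  let ?E = "{f :: 'k mpoly. keys f \<subseteq> B}"
  interpret H: ring_hom_ring "poly_ring s" "poly_ring s Quot J" ?h
    by (rule I.rcos_ring_hom_ring)
  have ne: "\<one>\<^bsub>poly_ring s Quot J\<^esub> \<noteq> \<zero>\<^bsub>poly_ring s Quot J\<^esub>"
    using coset_eq_zero_iff[of 1] assms(1) H.hom_one by simp
  have "inj_on ?h ?E"
  proof (rule inj_onI)
    fix f g assume "f \<in> ?E" "g \<in> ?E" "?h f = ?h g"
    then have "f - g \<in> J" "keys (f - g) \<subseteq> B"
      by (simp_all add: coset_eq_iff keys_diff_subset)
    then show "f = g" using indep by (auto simp: indep_mod_def)
  qed
  then have dim: "H.S.dimension (card B) (?h ` ?K) (?h ` ?E)"
    by (rule H.inj_hom_dimension[OF subfield_constants ne _ dimension_keys_subset[OF B]])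
  have "?h ` ?E = ?h ` V"
  proof
    show "?h ` V \<subseteq> ?h ` ?E"
    proof
      fix y assume "y \<in> ?h ` V"
      then obtain f g where "f \<in> V" "y = ?h f" "keys g \<subseteq> B" "f - g \<in> J"
        using V(2) by blast
      then show "y \<in> ?h ` ?E" by (auto simp: coset_eq_iff)
    qed
  qed (use V(1) in auto)
  with dim have "H.S.dimension (card B) (?h ` ?K) (?h ` V)" by simp
  from H.S.dimI[OF H.img_is_subfield(2)[OF subfield_constants ne] this]
  show ?thesis
    by (simp add: quot_dim_def over_def image_image)
qed


section \<open>Monomial ideals\<close>

definition mdvd :: "(nat \<Rightarrow>\<^sub>0 nat) \<Rightarrow> (nat \<Rightarrow>\<^sub>0 nat) \<Rightarrow> bool" where
  "mdvd a b \<longleftrightarrow> (\<forall>i. lookup a i \<le> lookup b i)"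

definition multiples :: "nat \<Rightarrow> (nat \<Rightarrow>\<^sub>0 nat) set \<Rightarrow> (nat \<Rightarrow>\<^sub>0 nat) set" where
  "multiples s G = {m \<in> monomials s. \<exists>g\<in>G. mdvd g m}"

lemma mdvd_refl: "mdvd a a"
  by (simp add: mdvd_def)

lemma mdvd_trans: "mdvd a b \<Longrightarrow> mdvd b c \<Longrightarrow> mdvd a c"
  unfolding mdvd_def using le_trans by blast

lemma mdvd_add: "mdvd a (b + a)"
  by (simp add: mdvd_def lookup_add)

lemma mdvd_diff_add: "mdvd a b \<Longrightarrow> b - a + a = b"
  by (rule poly_mapping_eqI) (simp add: mdvd_def lookup_add lookup_minus)

lemma monomials_diff: "b \<in> monomials s \<Longrightarrow> b - a \<in> monomials s"
  by (auto simp: monomials_def in_keys_iff lookup_minus)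

lemma multiples_add: "m \<in> multiples s G \<Longrightarrow> c \<in> monomials s \<Longrightarrow> c + m \<in> multiples s G"
  unfolding multiples_def using plus_in_monomials mdvd_trans mdvd_add by blast

lemma monomial_ideal_ideal: "ideal {f :: 'k::field mpoly. keys f \<subseteq> multiples s G} (poly_ring s)"
proof (rule poly_idealI)
  fix f g :: "'k mpoly"
  assume f: "f \<in> {f. keys f \<subseteq> multiples s G}" and g: "keys g \<subseteq> monomials s"
  have "m \<in> multiples s G" if "m \<in> keys (g * f)" for m
  proof -
    obtain a b where "m = a + b" "a \<in> keys g" "b \<in> keys f"
      using keys_mult[of g f] \<open>m \<in> keys (g * f)\<close> by blast
    then show ?thesis using f g multiples_add by blast
  qed
  then show "g * f \<in> {f. keys f \<subseteq> multiples s G}" by blast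
next
  fix f :: "'k mpoly"
  assume "f \<in> {f. keys f \<subseteq> multiples s G}"
  then show "keys f \<subseteq> monomials s" by (auto simp: multiples_def)
qed (simp_all add: keys_add_subset)

text \<open>A monomial with exponent in \<open>multiples s G\<close> is a monomial multiple of a
  generator, so membership is decided exponent by exponent. Later questions on \<open>L\<close> and
  \<open>(L, t^a)\<close> thereby become questions on exponent vectors.\<close>

theorem Idl_tpow:
  assumes "G \<subseteq> monomials s"
  shows "Idl\<^bsub>poly_ring s\<^esub> (tpow ` G) = {f :: 'k::field mpoly. keys f \<subseteq> multiples s G}" (is "?I = ?M")
proof -
  interpret R: cring "poly_ring s :: 'k mpoly ring" by (rule cring_poly_ring)
  have carr: "(tpow ` G :: 'k mpoly set) \<subseteq> carrier (poly_ring s)"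
    using assms by auto
  interpret I: poly_ideal s ?I
    by (rule poly_ideal.intro, rule R.genideal_ideal[OF carr])
  show ?thesis
  proof
    show "?I \<subseteq> ?M"
      using assms by (intro R.genideal_minimal monomial_ideal_ideal) (auto simp: multiples_def intro: mdvd_refl)
    show "?M \<subseteq> ?I"
    proof
      fix f :: "'k mpoly" assume f: "f \<in> ?M"
      have "tpow m \<in> ?I" if m: "m \<in> multiples s G" for m
      proof -
        obtain g where g: "g \<in> G" "mdvd g m" "m \<in> monomials s"
          using m by (auto simp: multiples_def)
        then have "tpow (m - g) * tpow g \<in> ?I"
          using R.genideal_self[OF carr] by (intro I.mult) (auto simp: monomials_diff)
        then show ?thesis using g by (simp add: tpow_mult mdvd_diff_add)
      qed
      then have "(\<Sum>m\<in>keys f. single 0 (lookup f m) * tpow m) \<in> ?I"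
        using f by (intro I.sum I.const_mult) auto
      then show "f \<in> ?I" by (simp flip: poly_expansion)
    qed
  qed
qed

text \<open>Presents \<open>(L, t^a)\<close> as generated by monomials, so that
  \<open>Idl_tpow\<close> applies to it.\<close>

lemma Idl_tpow_insert:
  assumes "G \<subseteq> monomials s" and "a \<in> monomials s"
  shows "Idl\<^bsub>poly_ring s\<^esub> (Idl\<^bsub>poly_ring s\<^esub> (tpow ` G) \<union> {tpow a}) =
    (Idl\<^bsub>poly_ring s\<^esub> (tpow ` insert a G) :: 'k::field mpoly set)"
proof -
  interpret R: cring "poly_ring s :: 'k mpoly ring" by (rule cring_poly_ring)
  have carr: "(tpow ` G :: 'k mpoly set) \<subseteq> carrier (poly_ring s)"
     "(tpow ` insert a G :: 'k mpoly set) \<subseteq> carrier (poly_ring s)"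
    using assms by auto
  let ?L = "Idl\<^bsub>poly_ring s\<^esub> (tpow ` G) :: 'k mpoly set"
  have L: "?L \<union> {tpow a} \<subseteq> carrier (poly_ring s)"
    using assms(2) poly_ideal.subset[OF poly_ideal.intro[OF R.genideal_ideal[OF carr(1)]]] by auto
  have self: "tpow ` insert a G \<subseteq> Idl\<^bsub>poly_ring s\<^esub> (tpow ` insert a G :: 'k mpoly set)"
    by (rule R.genideal_self[OF carr(2)])
  have "?L \<subseteq> Idl\<^bsub>poly_ring s\<^esub> (tpow ` insert a G)"
    by (rule R.subset_Idl_subset[OF carr(2)]) (rule image_mono, rule subset_insertI)
  with self have 1: "?L \<union> {tpow a} \<subseteq> Idl\<^bsub>poly_ring s\<^esub> (tpow ` insert a G)"
    by blast
  have "?L \<union> {tpow a} \<subseteq> Idl\<^bsub>poly_ring s\<^esub> (?L \<union> {tpow a})"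
    by (rule R.genideal_self[OF L])
  with R.genideal_self[OF carr(1)]
  have 2: "tpow ` insert a G \<subseteq> Idl\<^bsub>poly_ring s\<^esub> (?L \<union> {tpow a})"
    by blast
  show ?thesis
    by (rule subset_antisym[OF R.genideal_minimal[OF R.genideal_ideal[OF carr(2)] 1]
          R.genideal_minimal[OF R.genideal_ideal[OF L] 2]])
qed

lemma mdeg_eq_sum:
  assumes "finite A" and "keys a \<subseteq> A"
  shows "mdeg a = (\<Sum>i\<in>A. lookup a i)"
  unfolding mdeg_def using assms by (intro sum.mono_neutral_left) (auto simp: in_keys_iff)

lemma mdeg_monomials: "a \<in> monomials s \<Longrightarrow> mdeg a = (\<Sum>i=1..s. lookup a i)"
  by (rule mdeg_eq_sum) (auto simp: monomials_def)

lemma mdeg_add: "mdeg (a + b) = mdeg a + mdeg b"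
proof -
  let ?A = "keys a \<union> keys b"
  have "mdeg (a + b) = (\<Sum>i\<in>?A. lookup (a + b) i)"
    by (rule mdeg_eq_sum) (simp_all add: Poly_Mapping.keys_add)
  also have "\<dots> = mdeg a + mdeg b"
    by (simp add: lookup_add sum.distrib mdeg_eq_sum[of ?A a] mdeg_eq_sum[of ?A b])
  finally show ?thesis .
qed

lemma mdeg_single [simp]: "mdeg (single v n) = n"
  by (simp add: mdeg_def)

lemma mdeg_zero [simp]: "mdeg 0 = 0"
  by (simp add: mdeg_def)

lemma lookup_le_mdeg: "lookup a i \<le> mdeg a"
  unfolding mdeg_def by (cases "i \<in> keys a") (auto intro: member_le_sum simp: in_keys_iff)

lemma mdeg_eq_0_iff: "mdeg a = 0 \<longleftrightarrow> a = 0"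
  by (metis lookup_le_mdeg le_zero_eq lookup_zero mdeg_zero poly_mapping_eqI)

lemma single_in_monomials: "v \<in> {1..s} \<Longrightarrow> single v n \<in> monomials s"
  by (auto simp: monomials_def)

lemma finite_monomials_mdeg: "finite {m \<in> monomials s. mdeg m = n}"
proof -
  let ?F = "{f. \<forall>x. (x \<in> {1..s} \<longrightarrow> f x \<in> {..n}) \<and> (x \<notin> {1..s} \<longrightarrow> f x = 0)} :: (nat \<Rightarrow> nat) set"
  have "lookup m x \<le> n \<and> (x \<notin> {1..s} \<longrightarrow> lookup m x = 0)" if "m \<in> monomials s" "mdeg m = n" for m x
    using lookup_le_mdeg[of m x] that unfolding monomials_def
    by (metis in_keys_iff mem_Collect_eq subsetD)
  then have "lookup ` {m \<in> monomials s. mdeg m = n} \<subseteq> ?F"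
    by auto
  moreover have "finite ?F"
    by (rule finite_set_of_finite_funs) auto
  moreover have "inj_on lookup {m \<in> monomials s. mdeg m = n}"
    by (auto simp: inj_on_def poly_mapping.lookup_inject)
  ultimately show ?thesis
    using finite_imageD finite_subset by blast
qed


section \<open>Rings of dimension one\<close>

text \<open>Krull's argument: an ideal maximal among those containing \<open>I\<close> and disjoint
  from the multiplicative set \<open>T\<close> is prime.\<close>

lemma (in cring) exists_primeideal_avoiding:
  assumes I: "ideal I R" and T: "T \<subseteq> carrier R" "\<one> \<in> T"
    and mult: "\<And>a b. a \<in> T \<Longrightarrow> b \<in> T \<Longrightarrow> a \<otimes> b \<in> T"
    and disj: "I \<inter> T = {}"
  shows "\<exists>P. primeideal P R \<and> I \<subseteq> P \<and> P \<inter> T = {}"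
proof -
  let ?A = "{J. ideal J R \<and> I \<subseteq> J \<and> J \<inter> T = {}}"
  have "\<exists>M\<in>?A. \<forall>X\<in>?A. M \<subseteq> X \<longrightarrow> X = M"
  proof (rule subset_Zorn_nonempty)
    fix C assume C: "C \<noteq> {}" "subset.chain ?A C"
    then have "subset.chain {J. ideal J R} C" "C \<subseteq> ?A"
      by (auto simp: pred_on.chain_def)
    then show "\<Union>C \<in> ?A"
      using chain_Union_is_ideal[of C] C(1) by auto
  qed (use I disj in auto)
  then obtain M where "M \<in> ?A" and M_max: "\<forall>X\<in>?A. M \<subseteq> X \<longrightarrow> X = M" by blast
  then have M: "ideal M R" "I \<subseteq> M" "M \<inter> T = {}" by simp_all
  have max: "X = M" if "ideal X R" "M \<subseteq> X" "X \<inter> T = {}" for X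
    using M_max M(2) that by blast
  interpret M: ideal M R by (rule M(1))
  \<comment> \<open>By maximality, adjoining \<open>a\<close> to \<open>M\<close> must produce an
    element of \<open>T\<close>.\<close>
  have meets: "\<exists>m\<in>M. \<exists>r\<in>carrier R. m \<oplus> r \<otimes> a \<in> T" if a: "a \<in> carrier R" "a \<notin> M" for a
  proof -
    let ?X = "M <+>\<^bsub>R\<^esub> PIdl a"
    have X: "ideal ?X R"
      by (intro add_ideals M(1) cgenideal_ideal a(1))
    have "x \<in> ?X" if "x \<in> M" for x
    proof -
      have "x = x \<oplus> \<zero> \<otimes> a" using that a(1) by simp
      then show ?thesis using that unfolding set_add_def' cgenideal_def by blast
    qed
    moreover have "a \<in> ?X"
    proof -
      have "a = \<zero> \<oplus> \<one> \<otimes> a" using a(1) by simp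
      then show ?thesis using M.zero_closed unfolding set_add_def' cgenideal_def by blast
    qed
    ultimately have "?X \<inter> T \<noteq> {}"
      using max[OF X] a(2) by blast
    then show ?thesis unfolding set_add_def' cgenideal_def by blast
  qed
  have "primeideal M R"
  proof (rule primeidealI[OF M(1) is_cring])
    show "carrier R \<noteq> M" using M(3) T by auto
  next
    fix a b assume ab: "a \<in> carrier R" "b \<in> carrier R" "a \<otimes> b \<in> M"
    show "a \<in> M \<or> b \<in> M"
    proof (rule ccontr)
      assume "\<not> (a \<in> M \<or> b \<in> M)"
      then obtain m r m' r' where *: "m \<in> M" "r \<in> carrier R" "m \<oplus> r \<otimes> a \<in> T"
        "m' \<in> M" "r' \<in> carrier R" "m' \<oplus> r' \<otimes> b \<in> T"
        using meets[OF ab(1)] meets[OF ab(2)] by blast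
      have carr: "m \<in> carrier R" "m' \<in> carrier R"
        using * M.a_Hcarr by auto
      \<comment> \<open>Every term of the expanded product contains \<open>m\<close>,
        \<open>m'\<close> or the product of \<open>a\<close> and \<open>b\<close>, hence lies in
        \<open>M\<close>, while the product itself lies in \<open>T\<close>.\<close>
      have "(m \<oplus> r \<otimes> a) \<otimes> (m' \<oplus> r' \<otimes> b) =
          (m' \<oplus> r' \<otimes> b) \<otimes> m \<oplus> ((r \<otimes> a) \<otimes> m' \<oplus> (r \<otimes> r') \<otimes> (a \<otimes> b))"
        using carr * ab by algebra
      also have "\<dots> \<in> M"
        by (intro M.a_closed M.I_l_closed[OF *(1)] M.I_l_closed[OF *(4)] M.I_l_closed[OF ab(3)])
          (use carr * ab in auto)
      finally show False using mult[OF *(3,6)] M(3) by blast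
    qed
  qed
  then show ?thesis using M by blast
qed

section \<open>Primes of S/J and primes of S containing J\<close>

context poly_ideal
begin

text \<open>Carries a chain of primes above \<open>J\<close> into the quotient. Since
  \<open>J\<close> lies in \<open>P\<close>, the image remembers membership in \<open>P\<close>, so
  strict inclusions survive.\<close>

lemma primeideal_quot_image:
  assumes "primeideal P (poly_ring s)" and "J \<subseteq> P"
  shows "primeideal ((+>\<^bsub>poly_ring s\<^esub>) J ` P) (poly_ring s Quot J)"
    and "J +>\<^bsub>poly_ring s\<^esub> f \<in> (+>\<^bsub>poly_ring s\<^esub>) J ` P \<longleftrightarrow> f \<in> P"
proof -
  interpret P: primeideal P "poly_ring s" by (rule assms(1))
  interpret P': poly_ideal s P by (rule poly_ideal.intro) (rule P.is_ideal)
  have mem: "J +>\<^bsub>poly_ring s\<^esub> f \<in> (+>\<^bsub>poly_ring s\<^esub>) J ` P \<longleftrightarrow> f \<in> P" for f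
  proof
    assume "J +>\<^bsub>poly_ring s\<^esub> f \<in> (+>\<^bsub>poly_ring s\<^esub>) J ` P"
    then obtain p where p: "p \<in> P" "f - p \<in> J"
      by (auto simp: coset_eq_iff)
    then have "(f - p) + p \<in> P"
      using assms(2) by (intro P'.add) auto
    then show "f \<in> P" by simp
  qed auto
  show "primeideal ((+>\<^bsub>poly_ring s\<^esub>) J ` P) (poly_ring s Quot J)"
  proof (rule primeidealI)
    show "ideal ((+>\<^bsub>poly_ring s\<^esub>) J ` P) (poly_ring s Quot J)"
      by (rule R.ring_ideal_imp_quot_ideal[OF is_ideal P.is_ideal])
    show "cring (poly_ring s Quot J)"
      by (rule I.quotient_is_cring[OF R.is_cring])
    obtain f where f: "f \<in> carrier (poly_ring s)" "f \<notin> P"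
      using P.I_notcarr P.a_subset by blast
    then have "J +>\<^bsub>poly_ring s\<^esub> f \<in> carrier (poly_ring s Quot J)"
      unfolding quot_carrier by (intro imageI)
    moreover have "J +>\<^bsub>poly_ring s\<^esub> f \<notin> (+>\<^bsub>poly_ring s\<^esub>) J ` P"
      unfolding mem by (rule f(2))
    ultimately show "carrier (poly_ring s Quot J) \<noteq> (+>\<^bsub>poly_ring s\<^esub>) J ` P"
      by metis
  next
    fix x y
    assume "x \<in> carrier (poly_ring s Quot J)" "y \<in> carrier (poly_ring s Quot J)"
      and xy: "x \<otimes>\<^bsub>poly_ring s Quot J\<^esub> y \<in> (+>\<^bsub>poly_ring s\<^esub>) J ` P"
    then obtain f g where fg: "f \<in> carrier (poly_ring s)" "g \<in> carrier (poly_ring s)"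
      "x = J +>\<^bsub>poly_ring s\<^esub> f" "y = J +>\<^bsub>poly_ring s\<^esub> g"
      unfolding quot_carrier by (elim imageE)
    then have "J +>\<^bsub>poly_ring s\<^esub> (f \<otimes>\<^bsub>poly_ring s\<^esub> g) \<in> (+>\<^bsub>poly_ring s\<^esub>) J ` P"
      using xy ring_hom_mult[OF I.rcos_ring_hom fg(1,2)] by (simp only:)
    then have "f \<in> P \<or> g \<in> P"
      unfolding mem by (rule P.I_prime[OF fg(1,2)])
    then show "x \<in> (+>\<^bsub>poly_ring s\<^esub>) J ` P \<or> y \<in> (+>\<^bsub>poly_ring s\<^esub>) J ` P"
      using fg(3,4) by (simp only: mem)
  qed
  show "J +>\<^bsub>poly_ring s\<^esub> f \<in> (+>\<^bsub>poly_ring s\<^esub>) J ` P \<longleftrightarrow> f \<in> P"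
    by (rule mem)
qed

lemma primeideal_quot_vimage:
  assumes "primeideal Q (poly_ring s Quot J)"
  shows "primeideal {f \<in> carrier (poly_ring s). J +>\<^bsub>poly_ring s\<^esub> f \<in> Q} (poly_ring s)"
    and "J \<subseteq> {f \<in> carrier (poly_ring s). J +>\<^bsub>poly_ring s\<^esub> f \<in> Q}"
proof -
  interpret Q: primeideal Q "poly_ring s Quot J" by (rule assms)
  show "primeideal {f \<in> carrier (poly_ring s). J +>\<^bsub>poly_ring s\<^esub> f \<in> Q} (poly_ring s)"
    by (rule ring_hom_ring.primeideal_vimage[OF I.rcos_ring_hom_ring R.is_cring assms])
  have "J +>\<^bsub>poly_ring s\<^esub> f \<in> Q" if "f \<in> J" for f
    using that coset_eq_zero_iff[of f] Q.zero_closed by simp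
  then show "J \<subseteq> {f \<in> carrier (poly_ring s). J +>\<^bsub>poly_ring s\<^esub> f \<in> Q}"
    using I.a_subset by blast
qed

end

section \<open>Lower bound for the dimension: a prime strictly inside the irrelevant ideal\<close>

lemma lookup_mult_zero:
  fixes f g :: "'k::field mpoly"
  shows "lookup (f * g) 0 = lookup f 0 * lookup g 0"
proof -
  have zero: "l + q = 0 \<longleftrightarrow> l = 0 \<and> q = 0" for l q :: "nat \<Rightarrow>\<^sub>0 nat"
    by (metis add_0 add_is_0 mdeg_add mdeg_eq_0_iff)
  have "(\<Sum>q. lookup g q when (0::nat \<Rightarrow>\<^sub>0 nat) = l + q) = (lookup g 0 when l = 0)" for l
  proof -
    have "(\<lambda>q. lookup g q when (0::nat \<Rightarrow>\<^sub>0 nat) = l + q) = (\<lambda>q. (lookup g q when l = 0) when q = 0)"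
      using zero by (auto simp: fun_eq_iff when_def)
    then show ?thesis by (simp only: Sum_any_when_equal)
  qed
  then have "lookup (f * g) 0 = (\<Sum>l. lookup f l * lookup g 0 when l = 0)"
    by (simp only: lookup_mult mult_when)
  then show ?thesis by (simp only: Sum_any_when_equal)
qed

text \<open>This is the kernel of evaluation at the origin, which is multiplicative by
  \<open>lookup_mult_zero\<close> and has values in a field.\<close>

lemma primeideal_irrelevant:
  "primeideal {f :: 'k::field mpoly. keys f \<subseteq> monomials s \<and> lookup f 0 = 0} (poly_ring s)" (is "primeideal ?M _")
proof (rule primeidealI)
  show "ideal ?M (poly_ring s)"
    by (rule poly_idealI) (auto simp: lookup_mult_zero lookup_add keys_add_subset keys_mult_monomials)
  show "cring (poly_ring s :: 'k mpoly ring)" by (rule cring_poly_ring)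
  have "1 \<in> carrier (poly_ring s :: 'k mpoly ring)" "1 \<notin> ?M"
    by (simp_all add: zero_in_monomials)
  then show "carrier (poly_ring s) \<noteq> ?M" by blast
qed (simp add: lookup_mult_zero)

lemma lookup_hom_component: "lookup (hom_component n f) m = (if mdeg m = n then lookup f m else 0)"
proof -
  have "lookup (hom_component n f) m = (\<Sum>m'\<in>{m \<in> keys f. mdeg m = n}. if m' = m then lookup f m else 0)"
    unfolding hom_component_def by (auto simp: lookup_sum lookup_single when_def intro!: sum.cong)
  then show ?thesis by (auto simp: in_keys_iff)
qed

lemma lookup_tpow_mult:
  fixes f :: "'k::field mpoly"
  shows "lookup (tpow a * f) (a + k) = lookup f k"
proof -
  have "tpow a * f = tpow a * (\<Sum>k\<in>keys f. single 0 (lookup f k) * tpow k)"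
    by (simp flip: poly_expansion)
  also have "\<dots> = (\<Sum>k\<in>keys f. single (a + k) (lookup f k))"
    by (simp add: sum_distrib_left tpow_def mult_single)
  finally have "lookup (tpow a * f) (a + k) = (\<Sum>k'\<in>keys f. if k' = k then lookup f k else 0)"
    by (auto simp: lookup_sum lookup_single when_def intro!: sum.cong)
  then show ?thesis by (auto simp: in_keys_iff)
qed

text \<open>Every other term of the product has degree above \<open>mdeg a\<close>, so the component
  sees only the constant term of \<open>u\<close>.\<close>

lemma hom_component_tpow_mult:
  fixes u :: "'k::field mpoly"
  shows "hom_component (mdeg a) (tpow a * u) = single 0 (lookup u 0) * tpow a"
proof (rule poly_mapping_eqI)
  fix m
  have "lookup (tpow a * u) m = 0" if "mdeg m = mdeg a" "m \<noteq> a"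
  proof (rule ccontr)
    assume "lookup (tpow a * u) m \<noteq> 0"
    then have "m \<in> keys (tpow a * u)" by (simp add: in_keys_iff)
    then obtain k where "m = a + k"
      using keys_mult[of "tpow a" u] by auto
    then show False using that by (simp add: mdeg_add mdeg_eq_0_iff)
  qed
  then show "lookup (hom_component (mdeg a) (tpow a * u)) m = lookup (single 0 (lookup u 0) * tpow a) m"
    using lookup_tpow_mult[of a u 0]
    by (auto simp: lookup_hom_component tpow_def lookup_single when_def)
qed

text \<open>A prime avoiding all \<open>t_v^n u\<close> with nonzero constant term in
  \<open>u\<close> contains only polynomials vanishing at the origin (take \<open>n = 0\<close>) and
  misses \<open>t_v\<close> (take \<open>u = 1\<close>), which does vanish there.\<close>

lemma exists_prime_below_irrelevant:
  fixes J :: "'k::field mpoly set"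
  assumes J: "graded_ideal s J" and v: "v \<in> {1..s}" and pow: "\<And>n. tpow (single v n) \<notin> J"
  shows "\<exists>P. primeideal P (poly_ring s) \<and> J \<subseteq> P \<and> P \<subset> {f. keys f \<subseteq> monomials s \<and> lookup f 0 = 0}"
proof -
  interpret poly_ideal s J
    using J by (auto simp: poly_ideal_def graded_ideal_def)
  let ?T = "{tpow (single v n) * u | n u. keys u \<subseteq> monomials s \<and> lookup u 0 \<noteq> 0} :: 'k mpoly set"
  have v': "keys (tpow (single v n) :: 'k mpoly) \<subseteq> monomials s" for n
    using single_in_monomials[OF v] by simp
  have "\<exists>P. primeideal P (poly_ring s) \<and> J \<subseteq> P \<and> P \<inter> ?T = {}"
  proof (rule R.exists_primeideal_avoiding[OF is_ideal])
    show "?T \<subseteq> carrier (poly_ring s)"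
    proof
      fix x assume "x \<in> ?T"
      then obtain n u where "x = tpow (single v n) * u" "keys u \<subseteq> monomials s" by blast
      then show "x \<in> carrier (poly_ring s)" 

        by (simp add: keys_mult_monomials single_in_monomials[OF v])
    qed
    have "\<one>\<^bsub>poly_ring s\<^esub> = tpow (single v 0) * (1 :: 'k mpoly)"
      by (simp add: tpow_def)
    moreover have "keys (1 :: 'k mpoly) \<subseteq> monomials s" "lookup (1 :: 'k mpoly) 0 \<noteq> 0"
      by (simp_all add: zero_in_monomials)
    ultimately show "\<one>\<^bsub>poly_ring s\<^esub> \<in> ?T" by blast
  next
    fix x y assume "x \<in> ?T" "y \<in> ?T"
    then obtain n u n' u' where *: "x = tpow (single v n) * u" "keys u \<subseteq> monomials s" "lookup u 0 \<noteq> 0"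
       "y = tpow (single v n') * u'" "keys u' \<subseteq> monomials s" "lookup u' 0 \<noteq> 0"
      by blast
    have "x \<otimes>\<^bsub>poly_ring s\<^esub> y = tpow (single v (n + n')) * (u * u')"
      unfolding single_add tpow_mult[symmetric] by (simp add: * mult_ac)
    moreover have "keys (u * u') \<subseteq> monomials s" "lookup (u * u') 0 \<noteq> 0"
      using * by (simp_all add: keys_mult_monomials lookup_mult_zero)
    ultimately show "x \<otimes>\<^bsub>poly_ring s\<^esub> y \<in> ?T" by blast
  next
    have False if "tpow (single v n) * u \<in> J" "lookup u 0 \<noteq> 0" for n u
    proof -
      \<comment> \<open>Gradedness enters here: the component of degree \<open>n\<close> is
        \<open>u(0) t_v^n\<close>, a nonzero scalar multiple of a power excluded from
        \<open>J\<close>.\<close>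
      have "hom_component (mdeg (single v n)) (tpow (single v n) * u) \<in> J"
        using J that(1) unfolding graded_ideal_def by blast
      then have "single 0 (lookup u 0) * tpow (single v n) \<in> J"
        unfolding hom_component_tpow_mult .
      then have "single 0 (inverse (lookup u 0)) * (single 0 (lookup u 0) * tpow (single v n)) \<in> J"
        by (rule const_mult)
      then have "tpow (single v n) \<in> J"
        using that(2) by (simp add: mult_single flip: mult.assoc)
      then show False using pow by blast
    qed
    then show "J \<inter> ?T = {}" by blast
  qed
  then obtain P where P: "primeideal P (poly_ring s)" "J \<subseteq> P" "P \<inter> ?T = {}" by blast
  then have sub: "keys f \<subseteq> monomials s" if "f \<in> P" for f
    using that poly_ideal.subset[OF poly_ideal.intro[OF primeideal.axioms(1)]] by blast
  have "lookup f 0 = 0" if f: "f \<in> P" for f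
  proof (rule ccontr)
    assume "lookup f 0 \<noteq> 0"
    moreover have "f = tpow (single v 0) * f" by (simp add: tpow_def)
    ultimately have "f \<in> ?T" using sub[OF f] by blast
    then show False using P(3) f by blast
  qed
  moreover have "tpow (single v 1) \<notin> P"
  proof -
    have "tpow (single v 1) = tpow (single v 1) * (1 :: 'k mpoly)" by simp
    moreover have "keys (1 :: 'k mpoly) \<subseteq> monomials s" "lookup (1 :: 'k mpoly) 0 \<noteq> 0"
      by (simp_all add: zero_in_monomials)
    ultimately have "tpow (single v 1) \<in> ?T" by blast
    then show ?thesis using P(3) by blast
  qed
  moreover have "single v 1 \<noteq> (0 :: nat \<Rightarrow>\<^sub>0 nat)"
    by (simp flip: Poly_Mapping.keys_eq_empty)
  then have "lookup (tpow (single v 1) :: 'k mpoly) 0 = 0"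
    by (simp add: tpow_def lookup_single_not_eq)
  ultimately show ?thesis
    using P sub v'[of 1] by blast
qed

section \<open>Upper bound for the dimension: counting products of powers\<close>

lemma exists_linear_relation:
  fixes G :: "'i \<Rightarrow> 'k::field mpoly"
  assumes "finite X" "finite B" "card B < card X" and G: "\<And>x. x \<in> X \<Longrightarrow> keys (G x) \<subseteq> B"
  shows "\<exists>c. (\<exists>x\<in>X. c x \<noteq> 0) \<and> (\<Sum>x\<in>X. single 0 (c x) * G x) = 0"
proof (cases "inj_on G X")
  case False
  \<comment> \<open>Linear dependence is a property of the set of values, so a repeated value is
    handled apart; it gives the relation with coefficients 1 and - 1.\<close>
  then obtain x y where xy: "x \<in> X" "y \<in> X" "x \<noteq> y" "G x = G y"
    by (auto simp: inj_on_def)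
  define c :: "'i \<Rightarrow> 'k" where "c = (\<lambda>_. 0)(x := 1, y := - 1)"
  have "(\<Sum>z\<in>X. single 0 (c z) * G z) = (\<Sum>z\<in>{x, y}. single 0 (c z) * G z)"
    using xy assms(1) by (intro sum.mono_neutral_right) (auto simp: c_def)
  also have "\<dots> = 0"
    using xy by (simp add: c_def single_uminus)
  finally show ?thesis
    using xy by (intro exI[of _ c]) (auto simp: c_def)
next
  case True
  interpret V: vector_space "\<lambda>c f. single 0 c * f :: 'k mpoly"
    by unfold_locales (simp_all add: algebra_simps single_add mult_single flip: mult.assoc)
  have "G x \<in> V.span (tpow ` B)" if "x \<in> X" for x
  proof -
    have "(\<Sum>m\<in>keys (G x). single 0 (lookup (G x) m) * tpow m) \<in> V.span (tpow ` B)"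
      using G[OF that] by (intro V.span_sum V.span_scale V.span_base) auto
    then show ?thesis by (simp flip: poly_expansion)
  qed
  then have "G ` X \<subseteq> V.span (tpow ` B)" by blast
  moreover have "card (tpow ` B :: 'k mpoly set) < card (G ` X)"
    using assms(3) card_image_le[OF assms(2), of "tpow :: _ \<Rightarrow> 'k mpoly"] card_image[OF True] by linarith
  ultimately have "V.dependent (G ` X)"
    using V.independent_span_bound[of "tpow ` B" "G ` X"] assms(2) by (meson finite_imageI leD)
  then obtain u where "\<exists>v\<in>G ` X. u v \<noteq> 0" "(\<Sum>v\<in>G ` X. single 0 (u v) * v) = 0"
    using V.dependent_finite[of "G ` X"] assms(1) by blast
  then show ?thesis
    by (intro exI[of _ "u \<circ> G"]) (simp add: sum.reindex[OF True])
qed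

text \<open>Read the sum as a polynomial in \<open>f\<close> starting at \<open>f^k\<close>.
  Primality of \<open>P\<close> cancels \<open>f^k\<close>, since \<open>f\<close> is outside
  \<open>P\<close>; what remains is \<open>F k\<close> plus a multiple of \<open>f\<close>, and
  \<open>f\<close> is in \<open>Q\<close>.\<close>

lemma lowest_coefficient_in_ideal:
  fixes P Q :: "'k::field mpoly set"
  assumes P: "primeideal P (poly_ring s)" and Q: "ideal Q (poly_ring s)" and "P \<subseteq> Q"
    and f: "f \<in> Q" "f \<notin> P" and F: "\<And>i. keys (F i) \<subseteq> monomials s"
    and sum: "(\<Sum>i\<le>N. F i * f ^ i) \<in> P" and k: "k \<le> N" "\<And>i. i < k \<Longrightarrow> F i = 0"
  shows "F k \<in> Q"
proof -
  interpret P: primeideal P "poly_ring s" by (rule P)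
  interpret P': poly_ideal s P by (rule poly_ideal.intro) (rule P.is_ideal)
  interpret Q: poly_ideal s Q by (rule poly_ideal.intro) (rule Q)
  have fm: "keys f \<subseteq> monomials s" by (rule Q.subset) (rule f)
  have pow: "f ^ n \<notin> P" for n
  proof (induction n)
    case 0
    then show ?case using P'.proper_iff P.I_notcarr by auto
  next
    case (Suc n)
    then show ?case
      using P.I_prime[of f "f ^ n"] f(2) fm keys_power_monomials[OF fm, of n] by auto
  qed
  let ?R = "\<Sum>i\<in>{k..N}. F i * f ^ (i - k)"
  have R: "keys ?R \<subseteq> monomials s"
    by (intro keys_sum_subset keys_mult_monomials F keys_power_monomials fm)
  have "(\<Sum>i\<le>N. F i * f ^ i) = (\<Sum>i\<in>{k..N}. F i * f ^ i)"
    using k by (intro sum.mono_neutral_right) (auto simp: not_le)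
  also have "\<dots> = f ^ k * ?R"
    unfolding sum_distrib_left
    by (intro sum.cong) (auto simp: mult_ac simp flip: power_add)
  finally have "f ^ k * ?R \<in> P" using sum by simp
  then have "?R \<in> P"
    using P.I_prime[of "f ^ k" ?R] pow R keys_power_monomials[OF fm] by auto
  then have "?R \<in> Q" using \<open>P \<subseteq> Q\<close> by blast
  moreover have "?R = F k + (\<Sum>i\<in>{Suc k..N}. F i * f ^ (i - k))"
    using k(1) by (subst sum.atLeast_Suc_atMost) auto
  moreover have "(\<Sum>i\<in>{Suc k..N}. F i * f ^ (i - k)) \<in> Q"
  proof (rule Q.sum)
    fix i assume "i \<in> {Suc k..N}"
    then have "F i * f ^ (i - k) = (F i * f ^ (i - k - 1)) * f"
      by (cases "i - k") auto
    also have "\<dots> \<in> Q"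
      by (intro Q.mult f keys_mult_monomials F keys_power_monomials fm)
    finally show "F i * f ^ (i - k) \<in> Q" .
  qed
  ultimately show ?thesis using Q.diff by fastforce
qed

lemma mdeg_keys_mult:
  assumes "\<forall>m\<in>keys f. mdeg m \<le> a" and "\<forall>m\<in>keys g. mdeg m \<le> b"
  shows "\<forall>m\<in>keys (f * g). mdeg m \<le> a + b"
proof
  fix m assume "m \<in> keys (f * g)"
  then obtain x y where "m = x + y" "x \<in> keys f" "y \<in> keys g"
    using keys_mult[of f g] by blast
  then show "mdeg m \<le> a + b"
    using assms by (auto simp: mdeg_add intro: add_mono)
qed

lemma mdeg_keys_power:
  fixes f :: "'k::field mpoly"
  assumes "\<forall>m\<in>keys f. mdeg m \<le> a"
  shows "\<forall>m\<in>keys (f ^ n). mdeg m \<le> n * a"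
proof (induction n)
  case (Suc n)
  show ?case
    unfolding power_Suc mult_Suc by (rule mdeg_keys_mult[OF assms Suc])
qed simp

text \<open>
  If \<open>f\<close> and \<open>g\<close> witnessed the strictness of \<open>P0 \<subset> P1 \<subset> P2\<close>, then the \<open>(N + 1)\<^sup>2\<close> products
  \<open>f^i g^j\<close> would outnumber the monomials, linearly many in \<open>N\<close>, that span their residue classes; a linear
  relation among them contradicts primality.
\<close>

lemma no_prime_chain_of_length_two:
  fixes J :: "'k::field mpoly set"
  assumes J: "ideal J (poly_ring s)"
    and fin: "\<And>n. finite (B n)" and card: "\<And>n. card (B n) \<le> C"
    and span: "\<And>n. spans_mod J (B n) {m \<in> monomials s. mdeg m = n}"
    and P: "primeideal P0 (poly_ring s)" "primeideal P1 (poly_ring s)" "primeideal P2 (poly_ring s)"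
    and chain: "J \<subseteq> P0" "P0 \<subset> P1" "P1 \<subset> P2"
  shows False
proof -
  interpret J: poly_ideal s J by (rule poly_ideal.intro) (rule J)
  note ideals = P[THEN primeideal.axioms(1)]
  interpret P2: poly_ideal s P2 by (rule poly_ideal.intro) (rule ideals(3))
  obtain f g where fg: "f \<in> P1" "f \<notin> P0" "g \<in> P2" "g \<notin> P1" using chain by blast
  have fm: "keys f \<subseteq> monomials s" and gm: "keys g \<subseteq> monomials s"
    using fg chain P2.subset by auto
  obtain e where e: "\<forall>m\<in>keys f \<union> keys g. mdeg m \<le> e"
    using finite_nat_set_iff_bounded_le[of "mdeg ` (keys f \<union> keys g)"] by auto
  \<comment> \<open>\<open>D\<close> bounds the degree of \<open>f^i g^j\<close> for
    \<open>i, j \<le> N\<close>. The choice of \<open>N\<close> makes \<open>(D + 1) * C\<close>, a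
    bound on the number of spanning monomials, at most \<open>N * (N + 1)\<close>, which is below
    the \<open>(N + 1)^2\<close> products.\<close>
  define N where "N = C * (2 * e + 1)"
  define D where "D = 2 * N * e"
  let ?B = "\<Union>n\<le>D. B n" and ?X = "{..N} \<times> {..N}"
  have "card ?B \<le> (\<Sum>n\<le>D. card (B n))" by (rule card_UN_le) simp
  also have "\<dots> \<le> (\<Sum>n\<le>D. C)" by (intro sum_mono card)
  also have "\<dots> = (D + 1) * C" by simp
  also have "\<dots> \<le> (2 * e + 1) * (N + 1) * C"
    unfolding D_def by (intro mult_right_mono) (auto simp: algebra_simps)
  also have "\<dots> = N * (N + 1)" by (simp add: N_def algebra_simps)
  also have "\<dots> < card ?X" by (simp add: card_cartesian_product)
  finally have card_less: "card ?B < card ?X" .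
  have span': "spans_mod J ?B {m \<in> monomials s. mdeg m \<le> D}"
    unfolding spans_mod_def
  proof
    fix m assume "m \<in> {m \<in> monomials s. mdeg m \<le> D}"
    then have m: "m \<in> {m' \<in> monomials s. mdeg m' = mdeg m}" "mdeg m \<le> D" by auto
    then obtain h where "keys h \<subseteq> B (mdeg m)" "tpow m - h \<in> J"
      using span[of "mdeg m"] unfolding spans_mod_def by blast
    then show "\<exists>h. keys h \<subseteq> ?B \<and> tpow m - h \<in> J" using m(2) by blast
  qed
  have "\<exists>h. keys h \<subseteq> ?B \<and> f ^ i * g ^ j - h \<in> J" if "i \<le> N" "j \<le> N" for i j
  proof (rule J.spans_mod_poly[OF span'])
    have "\<forall>m\<in>keys (f ^ i * g ^ j). mdeg m \<le> i * e + j * e"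
      using e by (intro mdeg_keys_mult mdeg_keys_power) auto
    moreover have "(i + j) * e \<le> 2 * N * e"
      using that by (intro mult_right_mono) auto
    then have "i * e + j * e \<le> D"
      by (simp add: D_def distrib_right)
    ultimately show "keys (f ^ i * g ^ j) \<subseteq> {m \<in> monomials s. mdeg m \<le> D}"
      using keys_mult_monomials[OF keys_power_monomials[OF fm] keys_power_monomials[OF gm], of i j] by fastforce
  qed
  then have "\<forall>x\<in>?X. \<exists>h. keys h \<subseteq> ?B \<and> f ^ fst x * g ^ snd x - h \<in> J" by auto
  then obtain H where H: "\<And>x. x \<in> ?X \<Longrightarrow> keys (H x) \<subseteq> ?B"
    "\<And>x. x \<in> ?X \<Longrightarrow> f ^ fst x * g ^ snd x - H x \<in> J"
    by metis
  obtain c where c: "\<exists>x\<in>?X. c x \<noteq> 0" "(\<Sum>x\<in>?X. single 0 (c x) * H x) = 0"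
    using exists_linear_relation[of ?X ?B H] card_less fin H(1) by auto
  have "(\<Sum>x\<in>?X. single 0 (c x) * (f ^ fst x * g ^ snd x - H x)) \<in> J"
    by (intro J.sum J.const_mult H(2))
  then have rel: "(\<Sum>x\<in>?X. single 0 (c x) * (f ^ fst x * g ^ snd x)) \<in> J"
    using c(2) by (simp add: right_diff_distrib sum_subtractf)
  \<comment> \<open>The relation is regrouped as a polynomial in \<open>f\<close> whose coefficients
    \<open>F i\<close> are polynomials in \<open>g\<close>.\<close>
  define F where "F i = (\<Sum>j\<le>N. single 0 (c (i, j)) * g ^ j)" for i
  have Fm: "keys (F i) \<subseteq> monomials s" for i
    unfolding F_def
    by (intro keys_sum_subset keys_mult_monomials keys_power_monomials gm) (auto simp: zero_in_monomials)
  have "(\<Sum>i\<le>N. F i * f ^ i) = (\<Sum>i\<le>N. \<Sum>j\<le>N. single 0 (c (i, j)) * (f ^ i * g ^ j))"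
    unfolding F_def sum_distrib_right by (simp add: mult_ac)
  also have "\<dots> = (\<Sum>x\<in>?X. single 0 (c x) * (f ^ fst x * g ^ snd x))"
    by (simp add: sum.cartesian_product split_def)
  finally have relF: "(\<Sum>i\<le>N. F i * f ^ i) \<in> P0" using rel chain(1) by auto
  let ?nz = "\<lambda>i. i \<le> N \<and> (\<exists>j\<le>N. c (i, j) \<noteq> 0)"
  define k where "k = (LEAST i. ?nz i)"
  have k: "?nz k" unfolding k_def using c(1) by (intro LeastI_ex[of ?nz]) auto
  have "F i = 0" if "i < k" for i
  proof -
    have "\<not> ?nz i" using not_less_Least[of i ?nz] that k_def by blast
    then have "c (i, j) = 0" if "j \<le> N" for j using that k \<open>i < k\<close> by auto
    then show ?thesis by (simp add: F_def)
  qed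
  \<comment> \<open>The lowest row \<open>k\<close> with a nonzero scalar yields an element of
    \<open>P1\<close> that is itself a polynomial in \<open>g\<close>, so the same lemma applies
    again, to \<open>P1\<close> and \<open>P2\<close>; it leaves a nonzero constant in
    \<open>P2\<close>.\<close>
  then have Fk: "F k \<in> P1"
    using lowest_coefficient_in_ideal[OF P(1) ideals(2) _ fg(1,2) Fm relF, of k] k chain by blast
  let ?nz' = "\<lambda>j. j \<le> N \<and> c (k, j) \<noteq> 0"
  define l where "l = (LEAST j. ?nz' j)"
  have l: "?nz' l" unfolding l_def using k by (intro LeastI_ex[of ?nz']) auto
  have "single 0 (c (k, j)) = (0 :: 'k mpoly)" if "j < l" for j
  proof -
    have "\<not> ?nz' j" using not_less_Least[of j ?nz'] that l_def by blast
    then show ?thesis using that l by auto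
  qed
  then have "single 0 (c (k, l)) \<in> P2"
    using lowest_coefficient_in_ideal[OF P(2) ideals(3) _ fg(3,4) _ Fk[unfolded F_def], of l] l chain
    by (auto simp: zero_in_monomials)
  then have "single 0 (inverse (c (k, l))) * single 0 (c (k, l)) \<in> P2" by (rule P2.const_mult)
  then have "1 \<in> P2" using l by (simp add: mult_single)
  then show False using P2.proper_iff primeideal.I_notcarr[OF P(3)] by auto
qed

theorem krull_dim_eq_1:
  fixes J :: "'k::field mpoly set"
  assumes J: "graded_ideal s J" and v: "v \<in> {1..s}" and pow: "\<And>n. tpow (single v n) \<notin> J"
    and fin: "\<And>n. finite (B n)" and card: "\<And>n. card (B n) \<le> C"
    and span: "\<And>n. spans_mod J (B n) {m \<in> monomials s. mdeg m = n}"
  shows "krull_dim (poly_ring s Quot J) = 1"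
proof -
  have ideal: "ideal J (poly_ring s)" using J by (simp add: graded_ideal_def)
  interpret poly_ideal s J by (rule poly_ideal.intro) (rule ideal)
  let ?Q = "poly_ring s Quot J" and ?h = "(+>\<^bsub>poly_ring s\<^esub>) J"
  let ?chain = "\<lambda>n (P :: nat \<Rightarrow> 'k mpoly set set). (\<forall>i\<le>n. primeideal (P i) ?Q) \<and> (\<forall>i<n. P i \<subset> P (Suc i))"
  obtain P M where P: "primeideal P (poly_ring s)" "J \<subseteq> P" "P \<subset> M" and M: "primeideal M (poly_ring s)"
    using exists_prime_below_irrelevant[OF J v pow] primeideal_irrelevant by blast
  have "J \<subseteq> M" using P by blast
  obtain f where f: "f \<in> M" "f \<notin> P" using P by blast
  have "?h f \<in> ?h ` M" "?h f \<notin> ?h ` P"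
    using f primeideal_quot_image(2)[OF P(1,2), of f] by blast+
  then have "?h ` P \<subset> ?h ` M" using P(3) by blast
  let ?c = "\<lambda>i::nat. if i = 0 then ?h ` P else ?h ` M"
  from \<open>?h ` P \<subset> ?h ` M\<close> have "?chain 1 ?c"
    using primeideal_quot_image(1)[OF P(1,2)] primeideal_quot_image(1)[OF M \<open>J \<subseteq> M\<close>] by auto
  then have "\<exists>P. ?chain 1 P" by (rule exI[of "?chain 1" ?c])
  then have "enat 1 \<in> {enat n | n. \<exists>P. ?chain n P}" by (intro CollectI exI[of _ 1] conjI refl)
  then have ge: "1 \<le> krull_dim ?Q"
    unfolding krull_dim_def one_enat_def by (rule Sup_upper)
  have "n \<le> 1" if "?chain n P" for n P
  proof (rule ccontr)
    assume "\<not> n \<le> 1"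
    then have n: "2 \<le> n" by simp
    let ?V = "\<lambda>Q. {f \<in> carrier (poly_ring s). ?h f \<in> Q}"
    have prime: "primeideal (P i) ?Q" if "i \<le> 2" for i
      using \<open>?chain n P\<close> that n by auto
    \<comment> \<open>Strictness survives the pull-back because every coset has a representative in
      S.\<close>
    have strict: "?V (P i) \<subset> ?V (P (Suc i))" if "i < 2" for i
    proof -
      have sub: "P i \<subset> P (Suc i)" using \<open>?chain n P\<close> that n by auto
      then obtain x where x: "x \<in> P (Suc i)" "x \<notin> P i" by blast
      have "P (Suc i) \<subseteq> carrier ?Q"
        using prime[of "Suc i"] that additive_subgroup.a_subset ideal.axioms(1) primeideal.axioms(1) by fastforce
      then obtain f where "f \<in> carrier (poly_ring s)" "x = ?h f"
        using x(1) unfolding quot_carrier by blast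
      then show ?thesis using sub x by blast
    qed
    show False
    proof (rule no_prime_chain_of_length_two[OF ideal fin card span])
      show "primeideal (?V (P 0)) (poly_ring s)" "primeideal (?V (P 1)) (poly_ring s)"
        "primeideal (?V (P 2)) (poly_ring s)" "J \<subseteq> ?V (P 0)"
        by (intro primeideal_quot_vimage prime; simp)+
      show "?V (P 0) \<subset> ?V (P 1)" "?V (P 1) \<subset> ?V (P 2)"
        using strict[of 0] strict[of 1] by (simp_all add: numeral_2_eq_2)
    qed
  qed
  then have "krull_dim ?Q \<le> 1"
    unfolding krull_dim_def one_enat_def by (intro Sup_least) auto
  with ge show ?thesis by (rule order_antisym[rotated])
qed

theorem quot_degree_eq_card:
  fixes J :: "'k::field mpoly set"
  assumes J: "graded_ideal s J" and v: "v \<in> {1..s}" and pow: "\<And>n. tpow (single v n) \<notin> J"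
    and B: "\<And>n. B n \<subseteq> {m \<in> monomials s. mdeg m = n}"
    and indep: "\<And>n. indep_mod J (B n)"
    and span: "\<And>n. spans_mod J (B n) {m \<in> monomials s. mdeg m = n}"
    and C: "\<And>n. n \<ge> n0 \<Longrightarrow> card (B n) = C"
  shows "quot_degree s J = real C"
proof -
  interpret poly_ideal s J using J by (simp add: graded_ideal_def poly_ideal_def)
  have fin: "finite (B n)" for n
    using B finite_monomials_mdeg by (rule finite_subset)
  \<comment> \<open>The sum absorbs the finitely many degrees below \<open>n0\<close> and gives the
    uniform bound that \<open>krull_dim_eq_1\<close> asks for.\<close>
  have "card (B n) \<le> C + (\<Sum>k<n0. card (B k))" for n
    using C[of n] member_le_sum[of n "{..<n0}" "\<lambda>k. card (B k)"] by (cases "n < n0") auto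
  from krull_dim_eq_1[OF J v pow fin this span]
  have dim: "krull_dim (poly_ring s Quot J) = 1" by simp
  have "hilbert_function s J n = card (B n)" for n
    unfolding hilbert_function_def
  proof (rule quot_dim_eq_card)
    show "1 \<notin> J" using pow[of 0] by (simp add: tpow_def)
    show "B n \<subseteq> monomials s" using B by blast
    show "f \<in> homogeneous_part s n" if "keys f \<subseteq> B n" for f :: "'k mpoly"
      using that B[of n] by (auto simp: homogeneous_part_def)
    show "\<exists>g. keys g \<subseteq> B n \<and> f - g \<in> J" if "f \<in> homogeneous_part s n" for f
      using that by (intro spans_mod_poly[OF span]) (auto simp: homogeneous_part_def)
  qed (rule fin indep)+
  \<comment> \<open>In dimension one the normalising exponent is 0 and the factorial is 1, so the
    degree is the limit of the Hilbert function itself.\<close>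
  then have "eventually (\<lambda>n. real C = real (hilbert_function s J n) / real n ^ 0) sequentially"
    using C by (auto simp: eventually_sequentially)
  then have "(\<lambda>n. real (hilbert_function s J n) / real n ^ 0) \<longlonglongrightarrow> real C"
    by (rule Lim_transform_eventually[OF tendsto_const])
  then have "lim (\<lambda>n. real (hilbert_function s J n) / real n ^ 0) = real C" by (rule limI)
  then show ?thesis unfolding quot_degree_def dim by (simp add: one_enat_def)
qed

section \<open>Degrees through standard monomials\<close>

definition standard_monomials :: "nat \<Rightarrow> 'k::field mpoly set \<Rightarrow> nat \<Rightarrow> (nat \<Rightarrow>\<^sub>0 nat) set" where
  "standard_monomials s J n = {m \<in> monomials s. mdeg m = n \<and> tpow m \<notin> J}"

text \<open>Each monomial is either in \<open>J\<close> or standard, and an element of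
  \<open>J\<close> has no standard exponent, so the standard monomials form a basis without any
  reduction.\<close>

lemma quot_degree_monomial_ideal:
  fixes J :: "'k::field mpoly set"
  assumes J: "J = {f. keys f \<subseteq> multiples s G}"
    and v: "v \<in> {1..s}" "\<And>n. tpow (single v n) \<notin> J"
    and card: "\<And>n. n \<ge> n0 \<Longrightarrow> card (standard_monomials s J n) = C"
  shows "quot_degree s J = real C"
proof (rule quot_degree_eq_card[where B = "standard_monomials s J", OF _ v _ _ _ card])
  have "keys (hom_component n f) \<subseteq> keys f" for n and f :: "'k mpoly"
    by (auto simp: in_keys_iff lookup_hom_component split: if_splits)
  then show "graded_ideal s J"
    unfolding J graded_ideal_def using monomial_ideal_ideal by blast
next
  fix n
  show "standard_monomials s J n \<subseteq> {m \<in> monomials s. mdeg m = n}"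
    by (auto simp: standard_monomials_def)
  have "f = 0" if "keys f \<subseteq> multiples s G" "keys f \<subseteq> standard_monomials s J n" for f :: "'k mpoly"
  proof -
    have "m \<notin> keys f" for m
      using that by (auto simp: standard_monomials_def J)
    then have "keys f = {}" by blast
    then show ?thesis by simp
  qed
  then show "indep_mod J (standard_monomials s J n)"
    unfolding indep_mod_def J by blast
  have "\<exists>g. keys g \<subseteq> standard_monomials s J n \<and> tpow m - g \<in> J" if m: "m \<in> monomials s" "mdeg m = n" for m
  proof (cases "tpow m \<in> J")
    case True
    then show ?thesis by (intro exI[of _ 0]) simp
  next
    case False
    then show ?thesis using m
      by (intro exI[of _ "tpow m"]) (simp add: standard_monomials_def J)
  qed
  then show "spans_mod J (standard_monomials s J n) {m \<in> monomials s. mdeg m = n}"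
    unfolding spans_mod_def by blast
qed

lemma monomial_orderD:
  assumes "monomial_order s r"
  shows "trans r" "antisym r" "wf (r - Id)"
    and "a \<in> monomials s \<Longrightarrow> (a, a) \<in> r"
    and "a \<in> monomials s \<Longrightarrow> b \<in> monomials s \<Longrightarrow> (a, b) \<in> r \<or> (b, a) \<in> r"
    and "a \<in> monomials s \<Longrightarrow> b \<in> monomials s \<Longrightarrow> c \<in> monomials s \<Longrightarrow> (a, b) \<in> r \<Longrightarrow> (a + c, b + c) \<in> r"
proof -
  have wo: "well_order_on (monomials s) r"
    using assms unfolding monomial_order_def by blast
  show "trans r" "antisym r" "wf (r - Id)"
    using wo unfolding well_order_on_def linear_order_on_def partial_order_on_def preorder_on_def by auto
  have "refl_on (monomials s) r" "total_on (monomials s) r"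
    using wo unfolding well_order_on_def linear_order_on_def partial_order_on_def preorder_on_def by auto
  then show "a \<in> monomials s \<Longrightarrow> (a, a) \<in> r"
    and "a \<in> monomials s \<Longrightarrow> b \<in> monomials s \<Longrightarrow> (a, b) \<in> r \<or> (b, a) \<in> r"
    unfolding refl_on_def total_on_def by (blast, cases "a = b") blast+
  show "a \<in> monomials s \<Longrightarrow> b \<in> monomials s \<Longrightarrow> c \<in> monomials s \<Longrightarrow> (a, b) \<in> r \<Longrightarrow> (a + c, b + c) \<in> r"
    using assms unfolding monomial_order_def by blast
qed

text \<open>Makes the definite description behind \<open>lead_exp\<close> meaningful: a maximum
  exists by finiteness and totality and is unique by antisymmetry.\<close>

lemma lead_exp:
  assumes r: "monomial_order s r" and f: "keys f \<subseteq> monomials s" "f \<noteq> 0"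
  shows "lead_exp r f \<in> keys f" and "m \<in> keys f \<Longrightarrow> (m, lead_exp r f) \<in> r"
proof -
  have "\<exists>m\<in>A. \<forall>m'\<in>A. (m', m) \<in> r" if "finite A" "A \<noteq> {}" "A \<subseteq> monomials s" for A
    using that
  proof (induction A rule: finite_ne_induct)
    case (singleton x)
    then show ?case using monomial_orderD(4)[OF r] by auto
  next
    case (insert x A)
    then obtain m where m: "m \<in> A" "\<forall>m'\<in>A. (m', m) \<in> r" by auto
    consider "(x, m) \<in> r" | "(m, x) \<in> r"
      using monomial_orderD(5)[OF r, of x m] insert.prems m(1) by blast
    then show ?case
    proof cases
      case 1
      then show ?thesis using m by blast
    next
      case 2
      then have "(m', x) \<in> r" if "m' \<in> A" for m'
        using m(2) that monomial_orderD(1)[OF r] by (meson transD)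
      then show ?thesis using monomial_orderD(4)[OF r, of x] insert.prems by auto
    qed
  qed
  then obtain m where m: "m \<in> keys f" "\<forall>m'\<in>keys f. (m', m) \<in> r"
    using f by (metis Poly_Mapping.finite_keys Poly_Mapping.keys_eq_empty)
  then have "lead_exp r f = m"
    unfolding lead_exp_def using monomial_orderD(2)[OF r]
    by (intro the_equality) (auto dest: antisymD)
  with m show "lead_exp r f \<in> keys f" "m' \<in> keys f \<Longrightarrow> (m', lead_exp r f) \<in> r" for m'
    by auto
qed

lemma initial_ideal_eq:
  fixes I :: "'k::field mpoly set"
  assumes r: "monomial_order s r" and I: "ideal I (poly_ring s)"
  shows "initial_ideal s r I = {f. keys f \<subseteq> multiples s {lead_exp r f | f. f \<in> I \<and> f \<noteq> 0}}"
proof -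
  interpret poly_ideal s I by (rule poly_ideal.intro) (rule I)
  let ?G = "{lead_exp r f | f. f \<in> I \<and> f \<noteq> 0}"
  have "?G \<subseteq> monomials s"
    using lead_exp(1)[OF r subset] subset by blast
  then have "Idl\<^bsub>poly_ring s\<^esub> (tpow ` ?G) = {f :: 'k mpoly. keys f \<subseteq> multiples s ?G}"
    by (rule Idl_tpow)
  moreover have "tpow ` ?G = ({tpow (lead_exp r f) | f. f \<in> I \<and> f \<noteq> 0} :: 'k mpoly set)"
    by blast
  ultimately show ?thesis unfolding initial_ideal_def by simp
qed

text \<open>Independence: the leading exponent of a nonzero element of \<open>I\<close> is never
  standard. Spanning: a nonstandard \<open>m\<close> is rewritten by an element of \<open>I\<close>
  whose leading exponent divides \<open>m\<close>, and the order is well-founded.\<close>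

theorem quot_degree_initial_ideal:
  fixes I :: "'k::field mpoly set"
  assumes r: "monomial_order s r" and I: "graded_ideal s I"
    and v: "v \<in> {1..s}" "\<And>n. tpow (single v n) \<notin> initial_ideal s r I"
    and card: "\<And>n. n \<ge> n0 \<Longrightarrow> card (standard_monomials s (initial_ideal s r I) n) = C"
  shows "quot_degree s I = real C"
proof -
  interpret poly_ideal s I using I by (simp add: graded_ideal_def poly_ideal_def)
  let ?G = "{lead_exp r f | f. f \<in> I \<and> f \<noteq> 0}"
  define B where "B = standard_monomials s (initial_ideal s r I)"
  have B: "m \<in> B n \<longleftrightarrow> m \<in> monomials s \<and> mdeg m = n \<and> m \<notin> multiples s ?G" for m n
    unfolding B_def standard_monomials_def initial_ideal_eq[OF r is_ideal] by simp
  have lead_multiples: "lead_exp r f \<in> multiples s ?G" if "f \<in> I" "f \<noteq> 0" for f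
    using lead_exp(1)[OF r subset that(2)] subset that mdvd_refl unfolding multiples_def by blast
  have pow: "tpow (single v n) \<notin> I" for n
  proof
    assume mem: "tpow (single v n) \<in> I"
    have "(tpow (single v n) :: 'k mpoly) \<noteq> 0"
      by (simp flip: Poly_Mapping.keys_eq_empty)
    moreover from this have "lead_exp r (tpow (single v n) :: 'k mpoly) = single v n"
      using lead_exp(1)[OF r subset[OF mem]] by simp
    ultimately have "single v n \<in> multiples s ?G"
      using lead_multiples[OF mem] by simp
    then show False
      using v(2)[of n] unfolding initial_ideal_eq[OF r is_ideal] by simp
  qed
  have span: "\<exists>g. keys g \<subseteq> B n \<and> tpow m - g \<in> I" if "m \<in> monomials s" "mdeg m = n" for m n
    using monomial_orderD(3)[OF r] that
  proof (induction m rule: wf_induct_rule)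
    case (less m)
    show ?case
    proof (cases "m \<in> multiples s ?G")
      case False
      then show ?thesis
        using less.prems zero by (intro exI[of _ "tpow m"]) (simp add: B)
    next
      case True
      then obtain f where f: "f \<in> I" "f \<noteq> 0" "mdvd (lead_exp r f) m"
        unfolding multiples_def by blast
      define c where "c = m - lead_exp r f"
      have c: "c \<in> monomials s" "c + lead_exp r f = m"
        using less.prems(1) monomials_diff mdvd_diff_add[OF f(3)] by (auto simp: c_def)
      \<comment> \<open>\<open>f\<close> may be inhomogeneous. Cutting its shifted multiple to
        degree \<open>n\<close> stays in the graded ideal \<open>I\<close> and keeps the term at
        \<open>m\<close>, so the reduction never leaves degree \<open>n\<close>.\<close>
      define h where "h = hom_component n (tpow c * f)"
      have "h \<in> I"
        using I mult[OF f(1), of "tpow c"] c(1) unfolding h_def graded_ideal_def by simp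
      have hm: "lookup h m = lookup f (lead_exp r f)"
        using less.prems(2) unfolding h_def by (simp add: lookup_hom_component flip: c(2)) (simp add: lookup_tpow_mult)
      then have hm0: "lookup h m \<noteq> 0"
        using lead_exp(1)[OF r subset[OF f(1)] f(2)] by (simp add: in_keys_iff)
      let ?less = "{m' \<in> monomials s. mdeg m' = n \<and> (m', m) \<in> r - Id}"
      have keys_h: "m' \<in> ?less" if "m' \<in> keys h" "m' \<noteq> m" for m'
      proof -
        have m': "mdeg m' = n" "m' \<in> keys (tpow c * f)"
          using that(1) by (auto simp: h_def in_keys_iff lookup_hom_component split: if_splits)
        then obtain k where k: "k \<in> keys f" "m' = c + k"
          using keys_mult[of "tpow c" f] by auto
        have "(k + c, lead_exp r f + c) \<in> r"
          using lead_exp[OF r subset[OF f(1)] f(2)] k(1) subset[OF f(1)] c(1)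
          by (intro monomial_orderD(6)[OF r]) auto
        then have "(m', m) \<in> r" using k(2) c(2) by (simp add: add.commute)
        moreover have "m' \<in> monomials s"
          using k c(1) subset[OF f(1)] plus_in_monomials by blast
        ultimately show ?thesis using m' that(2) by simp
      qed
      \<comment> \<open>Scaled so that the term at \<open>m\<close> cancels; all other exponents of
        \<open>h\<close> are smaller than \<open>m\<close>.\<close>
      let ?t = "tpow m - single 0 (1 / lookup h m) * h"
      have "spans_mod I (B n) ?less"
        unfolding spans_mod_def using less.IH by blast
      moreover have "keys ?t \<subseteq> ?less"
      proof
        fix m' assume m': "m' \<in> keys ?t"
        then have "m' \<noteq> m"
          using hm0 by (auto simp: in_keys_iff lookup_minus tpow_def)
        moreover from this m' have "m' \<in> keys h"
          by (auto simp: in_keys_iff lookup_minus tpow_def lookup_single)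
        ultimately show "m' \<in> ?less" using keys_h by blast
      qed
      ultimately obtain g where g: "keys g \<subseteq> B n" "?t - g \<in> I"
        using spans_mod_poly by blast
      have "(?t - g) + single 0 (1 / lookup h m) * h \<in> I"
        by (intro add g(2) const_mult \<open>h \<in> I\<close>)
      then show ?thesis using g(1) by (intro exI[of _ g]) (simp add: algebra_simps)
    qed
  qed
  show ?thesis
  proof (rule quot_degree_eq_card[where B = B, OF I v(1) pow])
    fix n
    show "B n \<subseteq> {m \<in> monomials s. mdeg m = n}" using B by auto
    show "indep_mod I (B n)"
      unfolding indep_mod_def
    proof (intro ballI impI, rule ccontr)
      fix f assume f: "f \<in> I" "keys f \<subseteq> B n" "f \<noteq> 0"
      then show False
        using lead_exp(1)[OF r subset[OF f(1)] f(3)] lead_multiples[OF f(1,3)] B by blast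
    qed
    show "spans_mod I (B n) {m \<in> monomials s. mdeg m = n}"
      unfolding spans_mod_def using span by blast
    show "n \<ge> n0 \<Longrightarrow> card (B n) = C" unfolding B_def by (rule card)
  qed
qed


section \<open>Counting exponent vectors in boxes\<close>

text \<open>The exponent of \<open>t_v\<close> is determined by the degree and the other exponents,
  and the bound on \<open>n\<close> leaves at least \<open>M\<close> for it. What is counted is a
  box in the remaining coordinates, independent of \<open>n\<close>.\<close>

lemma card_monomials_box:
  assumes v: "v \<in> {1..s}" and n: "n \<ge> (\<Sum>i\<in>{1..s} - {v}. hi i) + M"
  shows "card {b \<in> monomials s. mdeg b = n \<and> M \<le> lookup b v \<and>
      (\<forall>i\<in>{1..s} - {v}. lo i \<le> lookup b i \<and> lookup b i < hi i)} = (\<Prod>i\<in>{1..s} - {v}. hi i - lo i)"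
    (is "card ?S = _")
proof -
  let ?A = "{1..s} - {v}"
  have sum_v: "(\<Sum>i=1..s. g i) = g v + (\<Sum>i\<in>?A. g i)" for g :: "nat \<Rightarrow> nat"
    using v by (subst sum.remove[of _ v]) auto
  let ?P = "PiE ?A (\<lambda>i. {lo i..<hi i})"
  have "bij_betw (\<lambda>b. restrict (lookup b) ?A) ?S ?P"
    unfolding bij_betw_def
  proof
    show "inj_on (\<lambda>b. restrict (lookup b) ?A) ?S"
    proof (rule inj_onI)
      fix b b' assume b: "b \<in> ?S" "b' \<in> ?S" and eq: "restrict (lookup b) ?A = restrict (lookup b') ?A"
      have A: "lookup b i = lookup b' i" if "i \<in> ?A" for i
        using fun_cong[OF eq, of i] that by simp
      have bm: "b \<in> monomials s" "b' \<in> monomials s" using b by auto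
      have "mdeg b = lookup b v + (\<Sum>i\<in>?A. lookup b i)" "mdeg b' = lookup b' v + (\<Sum>i\<in>?A. lookup b' i)"
        by (simp_all only: mdeg_monomials[OF bm(1)] mdeg_monomials[OF bm(2)] sum_v)
      moreover have "(\<Sum>i\<in>?A. lookup b i) = (\<Sum>i\<in>?A. lookup b' i)"
        using A by (intro sum.cong) auto
      ultimately have "lookup b v = lookup b' v" using b by simp
      moreover have "lookup b i = 0 \<and> lookup b' i = 0" if "i \<notin> {1..s}" for i
        using b that by (auto simp: monomials_def in_keys_iff)
      ultimately have "lookup b i = lookup b' i" for i using A by (cases "i = v"; cases "i \<in> {1..s}") auto
      then show "b = b'" by (intro poly_mapping_eqI)
    qed
    show "(\<lambda>b. restrict (lookup b) ?A) ` ?S = ?P"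
    proof
      show "?P \<subseteq> (\<lambda>b. restrict (lookup b) ?A) ` ?S"
      proof
        fix \<phi> assume \<phi>: "\<phi> \<in> ?P"
        then have lt: "lo i \<le> \<phi> i \<and> \<phi> i < hi i" if "i \<in> ?A" for i
          using that by (auto simp: PiE_def Pi_def)
        have le: "(\<Sum>i\<in>?A. \<phi> i) \<le> (\<Sum>i\<in>?A. hi i)"
          using lt by (intro sum_mono less_imp_le) auto
        define g where "g i = (if i = v then n - (\<Sum>i\<in>?A. \<phi> i) else if i \<in> ?A then \<phi> i else 0)" for i
        define b where "b = Abs_poly_mapping g"
        have "finite {i. g i \<noteq> 0}"
          by (rule finite_subset[of _ "{1..s}"]) (use v in \<open>auto simp: g_def\<close>)
        then have lookup_b: "lookup b = g" unfolding b_def by (rule Abs_poly_mapping_inverse[OF CollectI])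
        have "b \<in> monomials s"
          using v by (auto simp: monomials_def in_keys_iff lookup_b g_def split: if_splits)
        moreover from this have "mdeg b = g v + (\<Sum>i\<in>?A. g i)"
          by (simp only: mdeg_monomials sum_v lookup_b)
        moreover have "(\<Sum>i\<in>?A. g i) = (\<Sum>i\<in>?A. \<phi> i)"
          by (intro sum.cong) (auto simp: g_def)
        ultimately have "b \<in> ?S"
          using le n lt by (auto simp: lookup_b g_def)
        moreover have "restrict (lookup b) ?A = \<phi>"
          using \<phi> by (auto simp: lookup_b g_def restrict_def fun_eq_iff PiE_def extensional_def)
        ultimately show "\<phi> \<in> (\<lambda>b. restrict (lookup b) ?A) ` ?S" by blast
      qed
    qed (auto simp: PiE_def Pi_def)
  qed
  then have "card ?S = card ?P" by (rule bij_betw_same_card)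
  then show ?thesis by (simp add: card_PiE)
qed

text \<open>With the other exponents bounded, large degree forces the exponent at \<open>p\<close>
  or at \<open>q\<close> to be large. The two alternatives then exclude each other and give disjoint
  boxes, each with one free coordinate.\<close>

lemma card_monomials_union_of_two_boxes:
  assumes pq: "p \<in> {1..s}" "q \<in> {1..s}" "p \<noteq> q"
    and n: "n \<ge> (\<Sum>i\<in>{1..s} - {p, q}. u i) + c + c' + x p + x q"
  shows "card {b \<in> monomials s. mdeg b = n \<and> (\<forall>i\<in>{1..s} - {p, q}. lookup b i < u i) \<and>
       (lookup b p < c \<or> lookup b q < c') \<and> (\<forall>i\<in>{1..s}. x i \<le> lookup b i)}
     = (\<Prod>i\<in>{1..s} - {p, q}. u i - x i) * ((c - x p) + (c' - x q))" (is "card ?S = _")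
proof -
  define A where "A = {1..s} - {p, q}"
  have Aq: "{1..s} - {q} = insert p A" and Ap: "{1..s} - {p} = insert q A"
    and all: "{1..s} = insert p (insert q A)" and notin: "p \<notin> A" "q \<notin> A"
    using pq by (auto simp: A_def)
  let ?S1 = "{b \<in> monomials s. mdeg b = n \<and> x q \<le> lookup b q \<and>
     (\<forall>i\<in>{1..s} - {q}. x i \<le> lookup b i \<and> lookup b i < (u(p := c)) i)}"
  \<comment> \<open>The lower bound \<open>c + x p\<close>, in place of \<open>x p\<close>,
    separates this box from \<open>?S1\<close>; \<open>big\<close> shows that nothing is
    lost.\<close>
  let ?S2 = "{b \<in> monomials s. mdeg b = n \<and> c + x p \<le> lookup b p \<and>
     (\<forall>i\<in>{1..s} - {p}. x i \<le> lookup b i \<and> lookup b i < (u(q := c')) i)}"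
  have sums: "(\<Sum>i\<in>insert p A. (u(p := c)) i) = c + (\<Sum>i\<in>A. u i)"
    "(\<Sum>i\<in>insert q A. (u(q := c')) i) = c' + (\<Sum>i\<in>A. u i)"
    using notin by (auto simp: A_def intro!: sum.cong)
  have prods: "(\<Prod>i\<in>insert p A. (u(p := c)) i - x i) = (c - x p) * (\<Prod>i\<in>A. u i - x i)"
    "(\<Prod>i\<in>insert q A. (u(q := c')) i - x i) = (c' - x q) * (\<Prod>i\<in>A. u i - x i)"
    using notin by (auto simp: A_def intro!: prod.cong)
  have n': "n \<ge> (\<Sum>i\<in>A. u i) + c + c' + x p + x q" using n by (simp only: A_def)
  have c1: "card ?S1 = (c - x p) * (\<Prod>i\<in>A. u i - x i)"
    unfolding prods(1)[symmetric] Aq[symmetric]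
    by (rule card_monomials_box[OF pq(2)]) (use n' in \<open>simp only: Aq sums\<close>)
  have c2: "card ?S2 = (c' - x q) * (\<Prod>i\<in>A. u i - x i)"
    unfolding prods(2)[symmetric] Ap[symmetric]
    by (rule card_monomials_box[OF pq(1)]) (use n' in \<open>simp only: Ap sums\<close>)
  have big: "c + x p \<le> lookup b p"
    if "b \<in> monomials s" "mdeg b = n" "\<forall>i\<in>A. lookup b i < u i" "lookup b q < c'" for b
  proof -
    have "mdeg b = (\<Sum>i\<in>insert p (insert q A). lookup b i)"
      using that(1) by (simp only: mdeg_monomials all)
    then have "mdeg b = lookup b p + (lookup b q + (\<Sum>i\<in>A. lookup b i))"
      using pq(3) notin by (simp add: A_def)
    moreover have "(\<Sum>i\<in>A. lookup b i) \<le> (\<Sum>i\<in>A. u i)"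
      using that(3) by (intro sum_mono less_imp_le) auto
    ultimately show ?thesis using that n' by linarith
  qed
  have S1: "b \<in> ?S1 \<longleftrightarrow> b \<in> monomials s \<and> mdeg b = n \<and> x q \<le> lookup b q \<and> x p \<le> lookup b p \<and>
      lookup b p < c \<and> (\<forall>i\<in>A. x i \<le> lookup b i \<and> lookup b i < u i)" for b
    unfolding Aq using notin by auto
  have S2: "b \<in> ?S2 \<longleftrightarrow> b \<in> monomials s \<and> mdeg b = n \<and> c + x p \<le> lookup b p \<and> x q \<le> lookup b q \<and>
      lookup b q < c' \<and> (\<forall>i\<in>A. x i \<le> lookup b i \<and> lookup b i < u i)" for b
    unfolding Ap using notin by auto
  have S: "b \<in> ?S \<longleftrightarrow> b \<in> monomials s \<and> mdeg b = n \<and> x p \<le> lookup b p \<and> x q \<le> lookup b q \<and>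
      (lookup b p < c \<or> lookup b q < c') \<and> (\<forall>i\<in>A. x i \<le> lookup b i \<and> lookup b i < u i)" for b
    unfolding A_def[symmetric] by (auto simp only: all ball_simps mem_Collect_eq)
  have "?S = ?S1 \<union> ?S2"
  proof (rule Set.set_eqI)
    fix b
    show "b \<in> ?S \<longleftrightarrow> b \<in> ?S1 \<union> ?S2"
      unfolding S Un_iff S1 S2 using big[of b] by auto
  qed
  moreover have "?S1 \<inter> ?S2 = {}"
  proof -
    have False if "b \<in> ?S1" "b \<in> ?S2" for b
      using that unfolding S1 S2 by simp
    then show ?thesis by blast
  qed
  moreover have "finite ?S1" "finite ?S2"
    by (rule finite_subset[OF _ finite_monomials_mdeg[of s n]], blast)+
  ultimately have "card ?S = card ?S1 + card ?S2"
    by (simp only: card_Un_disjoint)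
  also have "\<dots> = (\<Prod>i\<in>A. u i - x i) * ((c - x p) + (c' - x q))"
    unfolding c1 c2 by (simp add: algebra_simps)
  finally show ?thesis unfolding A_def .
qed

section \<open>Thickenings of two coordinate lines\<close>

lemma mdvd_single: "mdvd (single i n) b \<longleftrightarrow> n \<le> lookup b i"
  by (auto simp: mdvd_def lookup_single when_def)

lemma mdvd_single_plus_single:
  "i \<noteq> j \<Longrightarrow> mdvd (single i n + single j m) b \<longleftrightarrow> n \<le> lookup b i \<and> m \<le> lookup b j"
  by (auto simp: mdvd_def lookup_add lookup_single when_def split: if_splits)

lemma multiples_insert: "multiples s (insert a G) = multiples s G \<union> {m \<in> monomials s. mdvd a m}"
  by (auto simp: multiples_def)

text \<open>\<open>c\<close> bounds the exponent of \<open>t_p\<close> and so thickens the line of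
  \<open>t_q\<close>; likewise \<open>c'\<close> thickens the line of \<open>t_p\<close>. Working
  through \<open>multiples_iff\<close> hides the index shift between variables and degrees in the
  original generators.\<close>

locale two_lines =
  fixes s p q :: nat and u :: "nat \<Rightarrow> nat" and c c' :: nat
    and G :: "(nat \<Rightarrow>\<^sub>0 nat) set" and L :: "'k::field mpoly set"
  assumes p: "p \<in> {1..s}" and q: "q \<in> {1..s}" and pq: "p \<noteq> q"
    and c: "1 \<le> c" and c': "1 \<le> c'"
    and u: "i \<in> {1..s} - {p, q} \<Longrightarrow> 1 \<le> u i"
    and G: "G \<subseteq> monomials s"
    and multiples_iff: "b \<in> monomials s \<Longrightarrow> b \<in> multiples s G \<longleftrightarrow>
      \<not> ((\<forall>i\<in>{1..s} - {p, q}. lookup b i < u i) \<and> (lookup b p < c \<or> lookup b q < c'))"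
    and L: "L = Idl\<^bsub>poly_ring s\<^esub> (tpow ` G)"
begin

text \<open>The number of standard multiples of \<open>tpow a\<close> in large degree, one summand
  per line; truncated subtraction makes a summand vanish when no multiple lies on that line.
  \<open>loss 0\<close> is the degree of S/L.\<close>

definition loss :: "(nat \<Rightarrow>\<^sub>0 nat) \<Rightarrow> nat" where
  "loss a = (\<Prod>i\<in>{1..s} - {p, q}. u i - lookup a i) * ((c - lookup a p) + (c' - lookup a q))"

definition bound :: "(nat \<Rightarrow>\<^sub>0 nat) \<Rightarrow> nat" where
  "bound a = (\<Sum>i\<in>{1..s} - {p, q}. u i) + c + c' + lookup a p + lookup a q"

lemma L_eq: "L = {f. keys f \<subseteq> multiples s G}"
  unfolding L by (rule Idl_tpow[OF G])

lemma tpow_mem_L: "tpow b \<in> L \<longleftrightarrow> b \<in> multiples s G"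
  by (simp add: L_eq)

sublocale poly_ideal s L
  unfolding L_eq by (rule poly_ideal.intro) (rule monomial_ideal_ideal)

lemma standard_iff:
  "b \<in> monomials s \<Longrightarrow> tpow b \<notin> L \<longleftrightarrow>
    (\<forall>i\<in>{1..s} - {p, q}. lookup b i < u i) \<and> (lookup b p < c \<or> lookup b q < c')"
  unfolding tpow_mem_L using multiples_iff by blast

lemma power_notin_L: "v \<in> {p, q} \<Longrightarrow> tpow (single v n) \<notin> L"
  using p q pq c c' u
  by (subst standard_iff) (auto simp: single_in_monomials lookup_single when_def Suc_le_eq)

lemma card_standard_multiples:
  assumes a: "a \<in> monomials s" and n: "n \<ge> bound a"
  shows "card {b \<in> standard_monomials s L n. mdvd a b} = loss a"
proof -
  have "mdvd a b \<longleftrightarrow> (\<forall>i\<in>{1..s}. lookup a i \<le> lookup b i)" for b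
    unfolding mdvd_def using a by (metis le0 monomials_def in_keys_iff mem_Collect_eq subsetD)
  then have "{b \<in> standard_monomials s L n. mdvd a b} =
      {b \<in> monomials s. mdeg b = n \<and> (\<forall>i\<in>{1..s} - {p, q}. lookup b i < u i) \<and>
       (lookup b p < c \<or> lookup b q < c') \<and> (\<forall>i\<in>{1..s}. lookup a i \<le> lookup b i)}"
    unfolding standard_monomials_def using standard_iff by auto
  then show ?thesis
    unfolding loss_def using card_monomials_union_of_two_boxes[OF p q pq, of u c c' "lookup a" n] n
    by (simp only: bound_def)
qed

lemma card_standard: "n \<ge> bound 0 \<Longrightarrow> card (standard_monomials s L n) = loss 0"
  using card_standard_multiples[of 0 n] by (simp add: zero_in_monomials mdvd_def)

lemma exists_support:
  assumes "a \<in> monomials s" "a \<noteq> 0"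
  obtains i where "i \<in> {1..s}" "lookup a i \<ge> 1"
proof -
  obtain i where "i \<in> keys a" using assms(2) by (metis all_not_in_conv Poly_Mapping.keys_eq_empty)
  then have "i \<in> {1..s}" "lookup a i \<ge> 1"
    using assms(1) unfolding monomials_def by (blast, simp add: in_keys_iff)
  then show thesis by (rule that)
qed

text \<open>The standard monomials of \<open>(L, t^a)\<close> are those of \<open>L\<close> that
  \<open>t^a\<close> does not divide, so in large degree their number is
  \<open>loss 0 - loss a\<close>.\<close>

theorem quot_degree_insert:
  assumes a: "a \<in> monomials s" "a \<noteq> 0"
  shows "quot_degree s (Idl\<^bsub>poly_ring s\<^esub> (L \<union> {tpow a})) = real (loss 0) - real (loss a)"
proof -
  let ?J = "Idl\<^bsub>poly_ring s\<^esub> (L \<union> {tpow a})"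
  have "insert a G \<subseteq> monomials s" using G a by blast
  then have J: "?J = {f. keys f \<subseteq> multiples s (insert a G)}"
    unfolding L Idl_tpow_insert[OF G a(1)] by (rule Idl_tpow)
  have mem_J: "tpow m \<in> ?J \<longleftrightarrow> m \<in> multiples s (insert a G)" for m
    unfolding J by simp
  obtain i where i: "i \<in> {1..s}" "lookup a i \<ge> 1" using exists_support[OF a] by blast
  \<comment> \<open>One of the two lines is not along the variable \<open>i\<close> dividing
    \<open>t^a\<close>; the powers of its variable stay outside \<open>(L, t^a)\<close>, so the
    dimension is still one.\<close>
  define v where "v = (if i = p then q else p)"
  have v: "v \<in> {p, q}" "v \<noteq> i" using pq by (auto simp: v_def)
  have pow: "tpow (single v n) \<notin> ?J" for n
  proof -
    have "\<not> mdvd a (single v n)"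
      using i(2) v(2) by (auto simp: mdvd_def lookup_single when_def not_le intro!: exI[of _ i])
    then show ?thesis
      using power_notin_L[OF v(1), of n] unfolding mem_J tpow_mem_L multiples_insert by blast
  qed
  have "card (standard_monomials s ?J n) = loss 0 - loss a \<and> loss a \<le> loss 0" if "n \<ge> max (bound 0) (bound a)" for n
  proof -
    have fin: "finite (standard_monomials s L n)"
      by (rule finite_subset[OF _ finite_monomials_mdeg[of s n]]) (auto simp: standard_monomials_def)
    have "standard_monomials s ?J n = standard_monomials s L n - {b \<in> standard_monomials s L n. mdvd a b}"
      unfolding standard_monomials_def mem_J tpow_mem_L multiples_insert by blast
    then have "card (standard_monomials s ?J n) =
        card (standard_monomials s L n) - card {b \<in> standard_monomials s L n. mdvd a b}"
      using fin by (simp add: card_Diff_subset)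
    moreover have "card {b \<in> standard_monomials s L n. mdvd a b} \<le> card (standard_monomials s L n)"
      using fin by (intro card_mono) auto
    ultimately show ?thesis
      using that card_standard[of n] card_standard_multiples[OF a(1), of n] by simp
  qed
  moreover from this have "loss a \<le> loss 0" by blast
  moreover have "v \<in> {1..s}" using v(1) p q by blast
  ultimately show ?thesis
    using quot_degree_monomial_ideal[OF J _ pow, of "max (bound 0) (bound a)" "loss 0 - loss a"]
    by (simp add: of_nat_diff)
qed

lemma zero_divisor_tpow:
  assumes a: "a \<in> monomials s" "a \<noteq> 0"
  shows "zero_divisor (poly_ring s Quot L) (L +>\<^bsub>poly_ring s\<^esub> tpow a)"
proof -
  obtain i where i: "i \<in> {1..s}" "lookup a i \<ge> 1" using exists_support[OF a] by blast
  have "\<exists>y\<in>monomials s. tpow y \<notin> L \<and> tpow (a + y) \<in> L"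
  proof -
    \<comment> \<open>\<open>y\<close> is standard but at the edge in direction \<open>i\<close>:
      one more factor \<open>t_i\<close> puts it into \<open>L\<close>. For \<open>i\<close> equal
      to \<open>p\<close> or \<open>q\<close> the other of the two exponents already reaches its
      bound, so only direction \<open>i\<close> keeps \<open>y\<close> standard.\<close>
    define y where "y = (if i = p then single p (c - 1) + single q c'
      else if i = q then single p c + single q (c' - 1) else single i (u i - 1))"
    have y: "y \<in> monomials s"
      using p q i(1) by (auto simp: y_def intro!: plus_in_monomials single_in_monomials)
    moreover have "tpow y \<notin> L"
      unfolding standard_iff[OF y] using pq c c' u i(1)
      by (auto simp: y_def lookup_add lookup_single when_def Suc_le_eq)
    moreover have "tpow (a + y) \<in> L"
    proof -
      have ay: "a + y \<in> monomials s" by (rule plus_in_monomials[OF a(1) y])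
      consider "i = p" | "i = q" "i \<noteq> p" | "i \<in> {1..s} - {p, q}" using i(1) by blast
      then have "\<not> ((\<forall>i\<in>{1..s} - {p, q}. lookup (a + y) i < u i) \<and> (lookup (a + y) p < c \<or> lookup (a + y) q < c'))"
      proof cases
        case 3
        then have "\<not> lookup (a + y) i < u i"
          using i(2) by (auto simp: y_def lookup_add)
        then show ?thesis using 3 by blast
      qed (use pq i(2) in \<open>auto simp: y_def lookup_add lookup_single when_def not_less\<close>)
      then show ?thesis using standard_iff[OF ay] by blast
    qed
    ultimately show ?thesis by blast
  qed
  then obtain y where y: "y \<in> monomials s" "tpow y \<notin> L" "tpow (a + y) \<in> L" by blast
  let ?h = "(+>\<^bsub>poly_ring s\<^esub>) L"
  have carr: "(tpow a :: 'k mpoly) \<in> carrier (poly_ring s)" "(tpow y :: 'k mpoly) \<in> carrier (poly_ring s)"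
    using a y by simp_all
  have "?h (tpow a) \<otimes>\<^bsub>poly_ring s Quot L\<^esub> ?h (tpow y) = ?h (tpow a \<otimes>\<^bsub>poly_ring s\<^esub> tpow y)"
    using ring_hom_mult[OF I.rcos_ring_hom carr] by (rule sym)
  also have "\<dots> = ?h (tpow (a + y))" by (simp only: poly_ring_simps tpow_mult)
  also have "\<dots> = \<zero>\<^bsub>poly_ring s Quot L\<^esub>" unfolding coset_eq_zero_iff by (rule y(3))
  finally have "?h (tpow a) \<otimes>\<^bsub>poly_ring s Quot L\<^esub> ?h (tpow y) = \<zero>\<^bsub>poly_ring s Quot L\<^esub>" .
  moreover have "?h (tpow y) \<noteq> \<zero>\<^bsub>poly_ring s Quot L\<^esub>" unfolding coset_eq_zero_iff by (rule y(2))
  moreover have "?h (tpow y) \<in> carrier (poly_ring s Quot L)" "?h (tpow a) \<in> carrier (poly_ring s Quot L)"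
    unfolding quot_carrier by (rule imageI, rule carr)+
  ultimately show ?thesis unfolding zero_divisor_def by blast
qed

text \<open>A single member \<open>a\<close> of the footprint set bounds the maximum from below by
  \<open>loss 0 - loss a\<close>, while S/I has degree \<open>loss 0\<close>.\<close>

theorem fp_le_loss:
  assumes r: "monomial_order s r" and I: "graded_ideal s I" and LI: "L = initial_ideal s r I"
    and a: "a \<in> monomials s" "a \<noteq> 0" "tpow a \<notin> L"
  shows "fp s r I (mdeg a) \<le> real (loss a)"
proof -
  have deg: "quot_degree s I = real (loss 0)"
    using quot_degree_initial_ideal[OF r I p, of "bound 0"] power_notin_L[of p] card_standard
    unfolding LI[symmetric] by blast
  let ?F = "footprint_monomials s r I (mdeg a)"
  let ?D = "\<lambda>a. quot_degree s (Idl\<^bsub>poly_ring s\<^esub> (initial_ideal s r I \<union> {tpow a}))"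
  have aF: "a \<in> ?F"
    using a zero_divisor_tpow[OF a(1,2)] unfolding footprint_monomials_def LI[symmetric] by blast
  have "?F \<subseteq> {m \<in> monomials s. mdeg m = mdeg a}"
    by (auto simp: footprint_monomials_def)
  then have "finite ?F" using finite_monomials_mdeg finite_subset by blast
  then have "finite {?D b | b. b \<in> ?F}" by simp
  then have "?D a \<le> Max {?D b | b. b \<in> ?F}"
    using aF by (intro Max_ge) auto
  moreover have "?D a = real (loss 0) - real (loss a)"
    unfolding LI[symmetric] by (rule quot_degree_insert[OF a(1,2)])
  moreover have "fp s r I (mdeg a) = quot_degree s I - Max {?D b | b. b \<in> ?F}"
    using aF unfolding fp_def by auto
  ultimately show ?thesis using deg by linarith
qed

end

section \<open>The degree and the footprint function of the ideal \<open>L\<close>\<close>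

text \<open>
  The degree \<open>d j\<close> with \<open>j \<noteq> p + 1\<close> bounds the exponent of the variable with index \<open>j - 1\<close> if \<open>j \<le> p\<close> and
  with index \<open>j\<close> if \<open>j > p + 1\<close>; this is the inverse of that correspondence.
\<close>

definition degree_index :: "nat \<Rightarrow> nat \<Rightarrow> nat" where
  "degree_index p i = (if i < p then i + 1 else i)"

lemma degree_index_bij:
  assumes "1 \<le> p" "p < s"
  shows "bij_betw (degree_index p) ({1..s} - {p, p + 1}) ({2..s} - {p + 1})"
  by (rule bij_betw_byWitness[where f' = "\<lambda>j. if j \<le> p then j - 1 else j"])
    (use assms in \<open>auto simp: degree_index_def\<close>)

text \<open>There are \<open>s\<close> variables but \<open>s - 1\<close> degrees:
  \<open>t_p\<close> and \<open>t_{p+1}\<close> together answer to the single index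
  \<open>p + 1\<close>, which supplies the extra factor.\<close>

lemma prod_degree_index:
  fixes f :: "nat \<Rightarrow> 'a::comm_monoid_mult"
  assumes "1 \<le> p" "p < s"
  shows "(\<Prod>i\<in>{1..s} - {p, p + 1}. f (degree_index p i)) * f (p + 1) = (\<Prod>j=2..s. f j)"
proof -
  have "(\<Prod>i\<in>{1..s} - {p, p + 1}. f (degree_index p i)) = (\<Prod>j\<in>{2..s} - {p + 1}. f j)"
    by (rule prod.reindex_bij_betw[OF degree_index_bij[OF assms]])
  then show ?thesis
    using assms by (simp add: prod.remove[of "{2..s}" "p + 1"] mult.commute)
qed

lemma sum_degree_index:
  fixes f :: "nat \<Rightarrow> 'a::comm_monoid_add"
  assumes "1 \<le> p" "p < s"
  shows "(\<Sum>i\<in>{1..s} - {p, p + 1}. f (degree_index p i)) + f (p + 1) = (\<Sum>j=2..s. f j)"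
proof -
  have "(\<Sum>i\<in>{1..s} - {p, p + 1}. f (degree_index p i)) = (\<Sum>j\<in>{2..s} - {p + 1}. f j)"
    by (rule sum.reindex_bij_betw[OF degree_index_bij[OF assms]])
  then show ?thesis
    using assms by (simp add: sum.remove[of "{2..s}" "p + 1"] add.commute)
qed

locale near_complete_intersection =
  fixes s p :: nat and c d :: "nat \<Rightarrow> nat" and L :: "'k::field mpoly set"
  assumes p_range: "1 \<le> p" "p < s"
    and c_pos: "1 \<le> c p" "1 \<le> c (p + 1)"
    and d_p: "d (p + 1) = c p + c (p + 1)"
    and d_pos: "\<And>i. i \<in> {2..s} \<Longrightarrow> 1 \<le> d i"
    and L_def: "L = Idl\<^bsub>poly_ring s\<^esub>
           ({tpow (single i (d (i + 1))) | i. i \<in> {1..p - 1}}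
            \<union> {tpow (single p (c p) + single (p + 1) (c (p + 1)))}
            \<union> {tpow (single i (d i)) | i. i \<in> {p + 2..s}})"
begin

definition G :: "(nat \<Rightarrow>\<^sub>0 nat) set" where
  "G = (\<lambda>i. single i (d (degree_index p i))) ` ({1..s} - {p, p + 1}) \<union>
    {single p (c p) + single (p + 1) (c (p + 1))}"

lemma degree_index_mem: "i \<in> {1..s} - {p, p + 1} \<Longrightarrow> degree_index p i \<in> {2..s} - {p + 1}"
  using degree_index_bij[OF p_range] bij_betwE by blast

lemma variables_split: "{1..s} - {p, p + 1} = {1..p - 1} \<union> {p + 2..s}"
  using p_range by auto

sublocale two_lines s p "p + 1" "\<lambda>i. d (degree_index p i)" "c p" "c (p + 1)" G L
proof unfold_locales
  show "1 \<le> d (degree_index p i)" if "i \<in> {1..s} - {p, p + 1}" for i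
    using d_pos degree_index_mem[OF that] by blast
  show "G \<subseteq> monomials s"
    using p_range unfolding G_def by (auto intro!: plus_in_monomials single_in_monomials)
  fix b assume "b \<in> monomials s"
  then show "b \<in> multiples s G \<longleftrightarrow> \<not> ((\<forall>i\<in>{1..s} - {p, p + 1}. lookup b i < d (degree_index p i)) \<and>
      (lookup b p < c p \<or> lookup b (p + 1) < c (p + 1)))"
    unfolding multiples_def G_def
    by (simp add: bex_Un mdvd_single mdvd_single_plus_single not_less del: One_nat_def) blast
next
  have "(tpow ` G :: 'k mpoly set) = tpow ` (\<lambda>i. single i (d (degree_index p i))) ` {1..p - 1} \<union>
     tpow ` (\<lambda>i. single i (d (degree_index p i))) ` {p + 2..s} \<union>
     {tpow (single p (c p) + single (p + 1) (c (p + 1)))}"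
    unfolding G_def variables_split by (simp only: image_Un image_insert image_empty)
  moreover have "tpow ` (\<lambda>i. single i (d (degree_index p i))) ` {1..p - 1} =
      ({tpow (single i (d (i + 1))) | i. i \<in> {1..p - 1}} :: 'k mpoly set)"
    unfolding image_image Setcompr_eq_image
    by (intro image_cong refl) (use p_range in \<open>auto simp: degree_index_def\<close>)
  moreover have "tpow ` (\<lambda>i. single i (d (degree_index p i))) ` {p + 2..s} =
      ({tpow (single i (d i)) | i. i \<in> {p + 2..s}} :: 'k mpoly set)"
    unfolding image_image Setcompr_eq_image
    by (intro image_cong refl) (auto simp: degree_index_def)
  ultimately show "L = Idl\<^bsub>poly_ring s\<^esub> (tpow ` G)"
    unfolding L_def by (simp only: Un_ac)
qed (use p_range c_pos in auto)

text \<open>A standard monomial has exponents below the degrees in the variables other than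
  \<open>t_p\<close>, \<open>t_{p+1}\<close>, so those differences become real ones. The two
  remaining differences stay truncated; they carry the case distinction.\<close>

lemma real_loss:
  assumes a: "a \<in> monomials s" "tpow a \<notin> L"
  shows "real (loss a) = real ((c p - lookup a p) + (c (p + 1) - lookup a (p + 1))) *
     ((\<Prod>i=1..p - 1. real (d (i + 1)) - real (lookup a i)) * (\<Prod>i=p + 2..s. real (d i) - real (lookup a i)))"
proof -
  have le: "lookup a i \<le> d (degree_index p i)" if "i \<in> {1..s} - {p, p + 1}" for i
    using standard_iff[OF a(1)] a(2) that by (blast intro: less_imp_le)
  have "real (\<Prod>i\<in>{1..s} - {p, p + 1}. d (degree_index p i) - lookup a i) =
      (\<Prod>i\<in>{1..s} - {p, p + 1}. real (d (degree_index p i)) - real (lookup a i))"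
    unfolding of_nat_prod by (intro prod.cong refl of_nat_diff le)
  also have "\<dots> = (\<Prod>i=1..p - 1. real (d (degree_index p i)) - real (lookup a i)) *
      (\<Prod>i=p + 2..s. real (d (degree_index p i)) - real (lookup a i))"
    unfolding variables_split by (intro prod.union_disjoint) auto
  also have "(\<Prod>i=1..p - 1. real (d (degree_index p i)) - real (lookup a i)) =
      (\<Prod>i=1..p - 1. real (d (i + 1)) - real (lookup a i))"
    using p_range by (intro prod.cong refl) (auto simp: degree_index_def)
  also have "(\<Prod>i=p + 2..s. real (d (degree_index p i)) - real (lookup a i)) =
      (\<Prod>i=p + 2..s. real (d i) - real (lookup a i))"
    by (intro prod.cong refl) (auto simp: degree_index_def)
  finally show ?thesis unfolding loss_def by simp
qed

lemma loss_zero: "loss 0 = (\<Prod>i=2..s. d i)"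
  unfolding loss_def using prod_degree_index[OF p_range, of d] d_p by simp

text \<open>Every vector \<open>e\<close> below \<open>d\<close> is realised, so choosing a monomial
  reduces to choosing \<open>e\<close>.\<close>

lemma exists_monomial_with_loss:
  assumes e: "\<And>j. j \<in> {2..s} \<Longrightarrow> e j < d j"
  shows "\<exists>a\<in>monomials s. mdeg a = (\<Sum>j=2..s. e j) \<and> tpow a \<notin> L \<and> loss a = (\<Prod>j=2..s. d j - e j)"
proof -
  \<comment> \<open>The value \<open>e (p + 1)\<close> is shared between \<open>t_p\<close> and
    \<open>t_{p+1}\<close>: \<open>y < c (p + 1)\<close> keeps the monomial outside
    \<open>L\<close>, and the remainder satisfies \<open>x \<le> c p\<close>, so both differences in
    \<open>loss\<close> are exact.\<close>
  define y where "y = min (e (p + 1)) (c (p + 1) - 1)"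
  define x where "x = e (p + 1) - y"
  have "e (p + 1) < c p + c (p + 1)"
    using e[of "p + 1"] p_range d_p by simp
  then have xy: "x + y = e (p + 1)" "y < c (p + 1)" "(c p - x) + (c (p + 1) - y) = d (p + 1) - e (p + 1)"
    using c_pos d_p by (auto simp: x_def y_def)
  define w where "w i = (if i = p then x else if i = p + 1 then y else
     if i \<in> {1..s} then e (degree_index p i) else 0)" for i
  define a where "a = Abs_poly_mapping w"
  have "finite {i. w i \<noteq> 0}"
    by (rule finite_subset[of _ "{1..s}"]) (use p_range in \<open>auto simp: w_def\<close>)
  then have lookup_a: "lookup a = w"
    unfolding a_def by (rule Abs_poly_mapping_inverse[OF CollectI])
  have a: "a \<in> monomials s"
    using p_range by (auto simp: monomials_def in_keys_iff lookup_a w_def split: if_splits)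
  have "{1..s} = insert p (insert (p + 1) ({1..s} - {p, p + 1}))" using p_range by auto
  then have "mdeg a = (\<Sum>i\<in>insert p (insert (p + 1) ({1..s} - {p, p + 1})). w i)"
    using mdeg_monomials[OF a] lookup_a by (simp only:)
  also have "\<dots> = x + y + (\<Sum>i\<in>{1..s} - {p, p + 1}. w i)"
    by (simp add: w_def)
  also have "(\<Sum>i\<in>{1..s} - {p, p + 1}. w i) = (\<Sum>i\<in>{1..s} - {p, p + 1}. e (degree_index p i))"
    by (intro sum.cong) (auto simp: w_def)
  also have "x + y + \<dots> = (\<Sum>j=2..s. e j)"
    using sum_degree_index[OF p_range, of e] xy(1) by simp
  finally have deg: "mdeg a = (\<Sum>j=2..s. e j)" .
  have "lookup a i < d (degree_index p i)" if "i \<in> {1..s} - {p, p + 1}" for i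
    using e degree_index_mem[OF that] that by (simp add: lookup_a w_def)
  then have "tpow a \<notin> L"
    unfolding standard_iff[OF a] using xy(2) by (simp add: lookup_a w_def)
  moreover have "loss a = (\<Prod>j=2..s. d j - e j)"
  proof -
    have "(\<Prod>i\<in>{1..s} - {p, p + 1}. d (degree_index p i) - lookup a i) =
        (\<Prod>i\<in>{1..s} - {p, p + 1}. d (degree_index p i) - e (degree_index p i))"
      by (intro prod.cong) (auto simp: lookup_a w_def)
    moreover have "(c p - lookup a p) + (c (p + 1) - lookup a (p + 1)) = d (p + 1) - e (p + 1)"
      using xy(3) by (simp add: lookup_a w_def)
    ultimately show ?thesis
      unfolding loss_def using prod_degree_index[OF p_range, of "\<lambda>j. d j - e j"] by simp
  qed
  ultimately show ?thesis using a deg by blast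
qed

lemma fp_le:
  assumes r: "monomial_order s r" and I: "graded_ideal s I" and LI: "L = initial_ideal s r I"
    and k: "k \<le> s - 2" and l: "1 \<le> l" "l \<le> d (k + 2) - 1"
  shows "fp s r I ((\<Sum>i=2..k + 1. d i - 1) + l)
    \<le> (real (d (k + 2)) - real l) * (\<Prod>i=k + 3..s. real (d i))"
proof -
  \<comment> \<open>Exponents \<open>d j - 1\<close> reduce the first factors of the loss to 1,
    \<open>l\<close> goes to index \<open>k + 2\<close>, and the later factors stay whole.\<close>
  define e where "e j = (if j \<le> k + 1 then d j - 1 else if j = k + 2 then l else 0)" for j
  have split: "{2..s} = {2..k + 1} \<union> insert (k + 2) {k + 3..s}"
    using k p_range by auto
  have "e j < d j" if "j \<in> {2..s}" for j
    using d_pos[OF that] l by (auto simp: e_def)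
  then obtain a where a: "a \<in> monomials s" "mdeg a = (\<Sum>j=2..s. e j)" "tpow a \<notin> L"
    "loss a = (\<Prod>j=2..s. d j - e j)"
    using exists_monomial_with_loss by blast
  have "(\<Sum>j=2..s. e j) = (\<Sum>j=2..k + 1. e j) + (\<Sum>j\<in>insert (k + 2) {k + 3..s}. e j)"
    unfolding split by (rule sum.union_disjoint) auto
  also have "(\<Sum>j=2..k + 1. e j) = (\<Sum>i=2..k + 1. d i - 1)"
    by (intro sum.cong) (auto simp: e_def)
  also have "(\<Sum>j\<in>insert (k + 2) {k + 3..s}. e j) = l"
    by (simp add: e_def)
  finally have deg: "mdeg a = (\<Sum>i=2..k + 1. d i - 1) + l" using a(2) by simp
  have "(\<Prod>j=2..s. d j - e j) = (\<Prod>j=2..k + 1. d j - e j) * (\<Prod>j\<in>insert (k + 2) {k + 3..s}. d j - e j)"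
    unfolding split by (rule prod.union_disjoint) auto
  also have "(\<Prod>j=2..k + 1. d j - e j) = 1"
  proof (rule prod.neutral, rule ballI)
    fix j assume "j \<in> {2..k + 1}"
    then have "1 \<le> d j" "j \<le> k + 1" using d_pos[of j] split by auto
    then show "d j - e j = 1" by (simp add: e_def)
  qed
  also have "(\<Prod>j\<in>insert (k + 2) {k + 3..s}. d j - e j) = (d (k + 2) - l) * (\<Prod>j=k + 3..s. d j)"
    by (simp add: e_def)
  finally have loss_a: "loss a = (d (k + 2) - l) * (\<Prod>j=k + 3..s. d j)" using a(4) by simp
  have "a \<noteq> 0" using deg l(1) by auto
  then have "fp s r I (mdeg a) \<le> real (loss a)"
    by (rule fp_le_loss[OF r I LI a(1) _ a(3)])
  then show ?thesis
    unfolding deg loss_a using l by (simp add: of_nat_diff)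
qed

end

theorem lemma3p4:
  fixes s p :: nat
    and c d :: "nat \<Rightarrow> nat"
    and L :: "((nat \<Rightarrow>\<^sub>0 nat) \<Rightarrow>\<^sub>0 'k::field) set"
  assumes "s \<ge> 2"
    and "1 \<le> p" and "p \<le> s - 1"
    and "1 \<le> c p" and "c p \<le> c (p + 1)"
    and "d (p + 1) = c p + c (p + 1)"
    and "\<forall>i\<in>{2..s}. i \<noteq> p + 1 \<longrightarrow> d i \<ge> 1"
    and "L = Idl\<^bsub>poly_ring s\<^esub>
           ({tpow (Poly_Mapping.single i (d (i + 1))) | i. i \<in> {1..p - 1}}
            \<union> {tpow (Poly_Mapping.single p (c p) + Poly_Mapping.single (p + 1) (c (p + 1)))}
            \<union> {tpow (Poly_Mapping.single i (d i)) | i. i \<in> {p + 2..s}})"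
  shows
    "(\<forall>a\<in>monomials s. tpow a \<notin> L \<longrightarrow> (\<exists>i\<in>{1..s}. Poly_Mapping.lookup a i \<ge> 1) \<longrightarrow>
       (let e = (\<lambda>i. real (Poly_Mapping.lookup a i));
            D = quot_degree s (Idl\<^bsub>poly_ring s\<^esub> (L \<union> {tpow a}));
            Q = (\<Prod>i=1..p - 1. real (d (i + 1)) - e i) * (\<Prod>i=p + 2..s. real (d i) - e i)
        in
         (Poly_Mapping.lookup a p \<ge> c p \<longrightarrow>
            D = (\<Prod>i=2..s. real (d i)) - (real (c (p + 1)) - e (p + 1)) * Q) \<and>
         (Poly_Mapping.lookup a p < c p \<and> Poly_Mapping.lookup a (p + 1) \<ge> c (p + 1) \<longrightarrow>
            D = (\<Prod>i=2..s. real (d i)) - (real (c p) - e p) * Q) \<and>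
         (Poly_Mapping.lookup a p < c p \<and> Poly_Mapping.lookup a (p + 1) < c (p + 1) \<longrightarrow>
            D = (\<Prod>i=2..s. real (d i)) - (real (d (p + 1)) - e p - e (p + 1)) * Q)))
     \<and>
     (\<forall>r I k l. graded_monomial_order s r \<longrightarrow> graded_ideal s I \<longrightarrow> L = initial_ideal s r I \<longrightarrow>
        k \<le> s - 2 \<longrightarrow> 1 \<le> l \<longrightarrow> l \<le> d (k + 2) - 1 \<longrightarrow>
        fp s r I ((\<Sum>i=2..k + 1. d i - 1) + l)
          \<le> (real (d (k + 2)) - real l) * (\<Prod>i=k + 3..s. real (d i)))"
proof -
  interpret near_complete_intersection s p c d L
  proof
    show "1 \<le> d i" if "i \<in> {2..s}" for i
      using assms(4,6,7) that by (cases "i = p + 1") auto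
  qed (use assms in auto)
  have "quot_degree s (Idl\<^bsub>poly_ring s\<^esub> (L \<union> {tpow a})) = (\<Prod>i=2..s. real (d i)) -
      real ((c p - lookup a p) + (c (p + 1) - lookup a (p + 1))) *
      ((\<Prod>i=1..p - 1. real (d (i + 1)) - real (lookup a i)) * (\<Prod>i=p + 2..s. real (d i) - real (lookup a i)))"
    and "lookup a p < c p \<or> lookup a (p + 1) < c (p + 1)"
    if "a \<in> monomials s" "tpow a \<notin> L" "\<exists>i\<in>{1..s}. lookup a i \<ge> 1" for a
  proof -
    have "a \<noteq> 0" using that(3) by auto
    then show "quot_degree s (Idl\<^bsub>poly_ring s\<^esub> (L \<union> {tpow a})) = (\<Prod>i=2..s. real (d i)) -
        real ((c p - lookup a p) + (c (p + 1) - lookup a (p + 1))) *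
        ((\<Prod>i=1..p - 1. real (d (i + 1)) - real (lookup a i)) * (\<Prod>i=p + 2..s. real (d i) - real (lookup a i)))"
      using quot_degree_insert[OF that(1)] unfolding real_loss[OF that(1,2)] loss_zero by simp
    show "lookup a p < c p \<or> lookup a (p + 1) < c (p + 1)"
      using standard_iff[OF that(1)] that(2) by blast
  qed
  note degree = this
  show ?thesis
  proof (intro conjI ballI allI impI)
    fix a assume a: "a \<in> monomials s" "tpow a \<notin> L" "\<exists>i\<in>{1..s}. lookup a i \<ge> 1"
    show "let e = (\<lambda>i. real (lookup a i));
            D = quot_degree s (Idl\<^bsub>poly_ring s\<^esub> (L \<union> {tpow a}));
            Q = (\<Prod>i=1..p - 1. real (d (i + 1)) - e i) * (\<Prod>i=p + 2..s. real (d i) - e i)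
        in
         (lookup a p \<ge> c p \<longrightarrow>
            D = (\<Prod>i=2..s. real (d i)) - (real (c (p + 1)) - e (p + 1)) * Q) \<and>
         (lookup a p < c p \<and> lookup a (p + 1) \<ge> c (p + 1) \<longrightarrow>
            D = (\<Prod>i=2..s. real (d i)) - (real (c p) - e p) * Q) \<and>
         (lookup a p < c p \<and> lookup a (p + 1) < c (p + 1) \<longrightarrow>
            D = (\<Prod>i=2..s. real (d i)) - (real (d (p + 1)) - e p - e (p + 1)) * Q)"
      \<comment> \<open>In case (i) the first truncated difference is 0 and \<open>degree(2)\<close>
        makes the second exact; in (ii.1) the second is 0; in (ii.2) both are exact and add up to
        the factor with \<open>d (p + 1)\<close>.\<close>
      unfolding Let_def degree(1)[OF a] using degree(2)[OF a] d_p
      by (auto simp: of_nat_diff)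
  next
    fix r I k l
    assume "graded_monomial_order s r" "graded_ideal s I" "L = initial_ideal s r I"
      "k \<le> s - 2" "1 \<le> l" "l \<le> d (k + 2) - 1"
    then show "fp s r I ((\<Sum>i=2..k + 1. d i - 1) + l)
          \<le> (real (d (k + 2)) - real l) * (\<Prod>i=k + 3..s. real (d i))"
      unfolding graded_monomial_order_def by (intro fp_le) auto
  qed
qed

end
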